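(* Let $n\ge 3$ and let $\mathbb{F}$ be an arbitrary infinite field. Then, among all $n$-dimensional $\mathbb{F}$-algebras satisfying the identity $[x,x]=0$, the algebras $\mathfrak{r}_n$ and $\mathfrak{h}_n$ are the only ones (up to isomorphism) which have the $n$-dimensional abelian Lie algebra $\mathfrak{a}_n$ as their only proper degeneration. That is, for an $n$-dimensional $\mathbb{F}$-algebra $\mathfrak{g}$ satisfying $[x,x]=0$ for all $x$, the following are equivalent: (a) the algebras to which $\mathfrak{g}$ properly degenerates are, up to isomorphism, exactly $\mathfrak{a}_n$; (b) $\mathfrak{g}\cong\mathfrak{r}_n$ or $\mathfrak{g}\cong\mathfrak{h}_n$.
   Context: An $n$-dimensional $\mathbb{F}$-algebra (not necessarily associative) is an $n$-dimensional $\mathbb{F}$-vector space with an $\mathbb{F}$-bilinear product $(x,y)\mapsto[x,y]$. Let $V$ be a fixed $n$-dimensional $\mathbb{F}$-vector space with a fixed ordered basis $(v_1^*,\ldots,v_n^* )$; every $n$-dimensional $\mathbb{F}$-algebra is isomorphic to one with underlying space $V$ (an algebra structure on $V$). Structure vectors: the structure vector of an algebra $\mathfrak{g}$ relative to an ordered basis $(b_1,\ldots,b_n)$ is $(\alpha_{ijk})_{1\le i,j,k\le n}\in\mathbb{F}^{n^3}$, where $[b_i,b_j]=\sum_{k=1}^n\alpha_{ijk}b_k$. A structure vector of $\mathfrak{g}$ is its structure vector relative to some ordered basis. Action: $G=\mathrm{GL}(n,\mathbb{F})$ acts on the right on $\mathbb{F}^{n^3}$ by change of basis: if $\boldsymbol\lambda$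 is the structure vector of an algebra structure relative to $(v_i^* )$ and $g=(g_{ij})\in G$, then $\boldsymbol\lambda g$ is the structure vector of the same algebra relative to the basis $v_j=\sum_i g_{ij}v_i^*$. $O(\boldsymbol\lambda)$ denotes the orbit of $\boldsymbol\lambda$ (equivalently, the set of all structure vectors of the algebra having $\boldsymbol\lambda$ as a structure vector), and $\overline{Y}$ denotes the closure of $Y\subseteq\mathbb{F}^{n^3}$ in the Zariski topology, whose closed sets are the common zero sets in $\mathbb{F}^{n^3}$ of sets of polynomials over $\mathbb{F}$ in $n^3$ indeterminates. Degeneration: $\mathfrak{g}_1$ degenerates (respectively, properly degenerates) to $\mathfrak{g}_2$ if there are structure vectors $\boldsymbol\lambda_1$ of $\mathfrak{g}_1$ and $\boldsymbol\lambda_2$ of $\mathfrak{g}_2$ with $\boldsymbol\lambda_2\in\overline{O(\boldsymbol\lambda_1)}$ (respectively, $\boldsymbol\lambda_2\in\overline{O(\boldsymbol\lambda_1)}\setminus O(\boldsymbol\lambda_1)$). Particular algebras on $V$: $\mathfrak{a}_n$ has all products zero. $\mathfrak{r}_n$ has as only nonzero products of basis elements $[v_i^*,v_n^*]=v_i^*=-[v_n^*,v_i^*]$ for $1\le i\le n-1$. $\mathfrak{h}_n$ has as only nonzero products of basis elements $[v_1^*,v_2^*]=v_3^*=-[v_2^*,v_1^*]$ (so $\mathfrak{h}_n\cong\mathfrak{h}_3\oplus\mathfrak{a}_{n-3}$ with $\mathfrak{h}_3$ the Heisenberg algebra). *)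

theory Defs
  imports
    "HOL-Analysis.Abstract_Topology"
    "HOL-Library.FuncSet"
    "HOL-Library.Poly_Mapping"
    "Jordan_Normal_Form.Matrix"
begin

text \<open>
  All indices are shifted to start at 0: the ordered basis (b_1, ..., b_n) is
  \<open>b 0, ..., b (n - 1)\<close>, matching the indexing of matrices.
\<close>

section \<open>Affine space of dimension n^3 and its Zariski topology\<close>

type_synonym index = "nat \<times> nat \<times> nat"

definition indices :: "nat \<Rightarrow> index set"
  where "indices n = {..<n} \<times> {..<n} \<times> {..<n}"

definition affine_space :: "nat \<Rightarrow> (index \<Rightarrow> 'f) set"
  where "affine_space n = indices n \<rightarrow>\<^sub>E UNIV"

text \<open>A polynomial is a finitely supported map from monomials to coefficients, a monomial being
  a finitely supported map from indeterminates to exponents.\<close>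

type_synonym ('x, 'f) mpolynomial = "('x \<Rightarrow>\<^sub>0 nat) \<Rightarrow>\<^sub>0 'f"

definition indeterminates :: "('x, 'f::zero) mpolynomial \<Rightarrow> 'x set"
  where "indeterminates p = (\<Union>m\<in>Poly_Mapping.keys p. Poly_Mapping.keys m)"

definition monomial_eval :: "('x \<Rightarrow>\<^sub>0 nat) \<Rightarrow> ('x \<Rightarrow> 'f::comm_semiring_1) \<Rightarrow> 'f"
  where "monomial_eval m x = (\<Prod>i\<in>Poly_Mapping.keys m. x i ^ Poly_Mapping.lookup m i)"

definition poly_eval :: "('x, 'f::comm_semiring_1) mpolynomial \<Rightarrow> ('x \<Rightarrow> 'f) \<Rightarrow> 'f"
  where "poly_eval p x =
    (\<Sum>m\<in>Poly_Mapping.keys p. Poly_Mapping.lookup p m * monomial_eval m x)"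

definition zero_set :: "nat \<Rightarrow> (index, 'f::comm_semiring_1) mpolynomial set \<Rightarrow> (index \<Rightarrow> 'f) set"
  where "zero_set n S = {x \<in> affine_space n. \<forall>p\<in>S. poly_eval p x = 0}"

definition zariski_closed :: "nat \<Rightarrow> (index \<Rightarrow> 'f::comm_semiring_1) set \<Rightarrow> bool"
  where "zariski_closed n Z \<longleftrightarrow>
    (\<exists>S. (\<forall>p\<in>S. indeterminates p \<subseteq> indices n) \<and> Z = zero_set n S)"

definition zariski_topology :: "nat \<Rightarrow> (index \<Rightarrow> 'f::comm_semiring_1) topology"
  where "zariski_topology n =
    topology (\<lambda>U. U \<subseteq> affine_space n \<and> zariski_closed n (affine_space n - U))"

lemma monomial_eval_superset:
  assumes "finite A" "Poly_Mapping.keys m \<subseteq> A"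
  shows "monomial_eval m x = (\<Prod>i\<in>A. x i ^ Poly_Mapping.lookup m i)"
  unfolding monomial_eval_def
  by (rule prod.mono_neutral_left) (use assms in \<open>auto simp: in_keys_iff\<close>)

lemma monomial_eval_add: "monomial_eval (m + m') x = monomial_eval m x * monomial_eval m' x"
proof -
  let ?A = "Poly_Mapping.keys m \<union> Poly_Mapping.keys m'"
  have "monomial_eval (m + m') x = (\<Prod>i\<in>?A. x i ^ Poly_Mapping.lookup (m + m') i)"
    by (rule monomial_eval_superset) (simp, rule Poly_Mapping.keys_add)
  also have "\<dots> = (\<Prod>i\<in>?A. x i ^ Poly_Mapping.lookup m i) * (\<Prod>i\<in>?A. x i ^ Poly_Mapping.lookup m' i)"
    by (simp add: lookup_add power_add prod.distrib)
  finally show ?thesis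
    using monomial_eval_superset[of ?A m x] monomial_eval_superset[of ?A m' x] by simp
qed

lemma poly_eval_superset:
  assumes "finite A" "Poly_Mapping.keys p \<subseteq> A"
  shows "poly_eval p x = (\<Sum>m\<in>A. Poly_Mapping.lookup p m * monomial_eval m x)"
  unfolding poly_eval_def
  by (rule sum.mono_neutral_left) (use assms in \<open>auto simp: in_keys_iff\<close>)

lemma poly_eval_zero [simp]: "poly_eval 0 x = 0"
  by (simp add: poly_eval_def)

lemma poly_eval_single [simp]: "poly_eval (Poly_Mapping.single m c) x = c * monomial_eval m x"
  by (simp add: poly_eval_superset[of "{m}"])

lemma poly_eval_add: "poly_eval (p + q) x = poly_eval p x + poly_eval q x"
proof -
  let ?A = "Poly_Mapping.keys p \<union> Poly_Mapping.keys q"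
  have "poly_eval (p + q) x = (\<Sum>m\<in>?A. Poly_Mapping.lookup (p + q) m * monomial_eval m x)"
    by (rule poly_eval_superset) (simp, rule Poly_Mapping.keys_add)
  also have "\<dots> = (\<Sum>m\<in>?A. Poly_Mapping.lookup p m * monomial_eval m x)
      + (\<Sum>m\<in>?A. Poly_Mapping.lookup q m * monomial_eval m x)"
    by (simp add: lookup_add algebra_simps sum.distrib)
  finally show ?thesis
    using poly_eval_superset[of ?A p x] poly_eval_superset[of ?A q x] by simp
qed

lemma poly_eval_sum: "poly_eval (\<Sum>i\<in>A. p i) x = (\<Sum>i\<in>A. poly_eval (p i) x)"
  by (induction A rule: infinite_finite_induct) (simp_all add: poly_eval_add)

lemma mpolynomial_sum_monomials:
  "p = (\<Sum>m\<in>Poly_Mapping.keys p. Poly_Mapping.single m (Poly_Mapping.lookup p m))"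
  by (rule poly_mapping_eqI)
    (simp add: lookup_sum lookup_single when_def in_keys_iff)

lemma poly_eval_mult: "poly_eval (p * q) x = poly_eval p x * poly_eval q x"
proof -
  have "p * q = (\<Sum>m\<in>Poly_Mapping.keys p. \<Sum>m'\<in>Poly_Mapping.keys q.
      Poly_Mapping.single (m + m') (Poly_Mapping.lookup p m * Poly_Mapping.lookup q m'))"
    by (subst mpolynomial_sum_monomials[of p], subst mpolynomial_sum_monomials[of q])
      (simp add: sum_product mult_single)
  then have "poly_eval (p * q) x = (\<Sum>m\<in>Poly_Mapping.keys p. \<Sum>m'\<in>Poly_Mapping.keys q.
      Poly_Mapping.lookup p m * Poly_Mapping.lookup q m' * (monomial_eval m x * monomial_eval m' x))"
    by (simp add: poly_eval_sum monomial_eval_add)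
  also have "\<dots> = poly_eval p x * poly_eval q x"
    by (simp add: poly_eval_def sum_product mult_ac)
  finally show ?thesis .
qed

lemma indeterminates_mult: "indeterminates (p * q) \<subseteq> indeterminates p \<union> indeterminates q"
proof
  fix i assume "i \<in> indeterminates (p * q)"
  then obtain m where m: "m \<in> Poly_Mapping.keys (p * q)" "i \<in> Poly_Mapping.keys m"
    by (auto simp: indeterminates_def)
  then obtain a b where "m = a + b" "a \<in> Poly_Mapping.keys p" "b \<in> Poly_Mapping.keys q"
    using keys_mult[of p q] by auto
  then show "i \<in> indeterminates p \<union> indeterminates q"
    using m Poly_Mapping.keys_add[of a b] by (auto simp: indeterminates_def)
qed

lemma zariski_closed_Un:
  fixes Z :: "(index \<Rightarrow> 'f::idom) set"
  assumes "zariski_closed n Z" "zariski_closed n Z'"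
  shows "zariski_closed n (Z \<union> Z')"
proof -
  obtain S where S: "\<forall>p\<in>S. indeterminates p \<subseteq> indices n" and Z: "Z = zero_set n S"
    using assms(1) unfolding zariski_closed_def by blast
  obtain S' where S': "\<forall>p\<in>S'. indeterminates p \<subseteq> indices n" and Z': "Z' = zero_set n S'"
    using assms(2) unfolding zariski_closed_def by blast
  define T where "T = (\<lambda>(p, q). p * q) ` (S \<times> S')"
  have "\<forall>p\<in>T. indeterminates p \<subseteq> indices n"
  proof
    fix r assume "r \<in> T"
    then obtain p q where "r = p * q" "p \<in> S" "q \<in> S'"
      by (auto simp: T_def)
    then show "indeterminates r \<subseteq> indices n"
      using S S' indeterminates_mult[of p q] by blast
  qed
  moreover have "Z \<union> Z' = zero_set n T"
  proof -
    have "(\<forall>r\<in>T. poly_eval r x = 0) \<longleftrightarrow>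
        (\<forall>p\<in>S. \<forall>q\<in>S'. poly_eval p x = 0 \<or> poly_eval q x = 0)" for x
      by (simp add: T_def poly_eval_mult)
    then show ?thesis
      unfolding Z Z' zero_set_def by blast
  qed
  ultimately show ?thesis
    unfolding zariski_closed_def by blast
qed

lemma zariski_closed_Inter:
  assumes "\<And>Z. Z \<in> \<Z> \<Longrightarrow> zariski_closed n Z"
  shows "zariski_closed n (affine_space n \<inter> \<Inter>\<Z>)"
proof -
  obtain S where S: "\<And>Z. Z \<in> \<Z> \<Longrightarrow> \<forall>p\<in>S Z. indeterminates p \<subseteq> indices n"
      "\<And>Z. Z \<in> \<Z> \<Longrightarrow> Z = zero_set n (S Z)"
    using assms unfolding zariski_closed_def by metis
  have "x \<in> affine_space n \<inter> \<Inter>\<Z> \<longleftrightarrow> x \<in> zero_set n (\<Union>(S ` \<Z>))" for x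
    using S(2) unfolding zero_set_def by blast
  then have "affine_space n \<inter> \<Inter>\<Z> = zero_set n (\<Union>(S ` \<Z>))"
    by blast
  moreover have "\<forall>p\<in>\<Union>(S ` \<Z>). indeterminates p \<subseteq> indices n"
    using S(1) by blast
  ultimately show ?thesis
    unfolding zariski_closed_def by blast
qed

lemma istopology_zariski:
  "istopology (\<lambda>U :: (index \<Rightarrow> 'f::idom) set.
     U \<subseteq> affine_space n \<and> zariski_closed n (affine_space n - U))"
  unfolding istopology_def
proof (intro conjI allI impI)
  fix U U' :: "(index \<Rightarrow> 'f) set"
  assume U: "U \<subseteq> affine_space n \<and> zariski_closed n (affine_space n - U)"
    and U': "U' \<subseteq> affine_space n \<and> zariski_closed n (affine_space n - U')"
  show "U \<inter> U' \<subseteq> affine_space n"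
    using U by blast
  show "zariski_closed n (affine_space n - U \<inter> U')"
    unfolding Diff_Int by (rule zariski_closed_Un) (use U U' in simp_all)
next
  fix \<K> :: "(index \<Rightarrow> 'f) set set"
  assume K: "\<forall>K\<in>\<K>. K \<subseteq> affine_space n \<and> zariski_closed n (affine_space n - K)"
  show "\<Union>\<K> \<subseteq> affine_space n"
    using K by blast
  have eq: "affine_space n - \<Union>\<K> = affine_space n \<inter> (\<Inter>K\<in>\<K>. affine_space n - K)"
    by auto
  show "zariski_closed n (affine_space n - \<Union>\<K>)"
    unfolding eq by (rule zariski_closed_Inter) (use K in blast)
qed

lemma openin_zariski:
  fixes U :: "(index \<Rightarrow> 'f::idom) set"
  shows "openin (zariski_topology n) U \<longleftrightarrow>
    U \<subseteq> affine_space n \<and> zariski_closed n (affine_space n - U)"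
  unfolding zariski_topology_def by (simp add: topology_inverse'[OF istopology_zariski])

lemma topspace_zariski [simp]:
  "topspace (zariski_topology n) = (affine_space n :: (index \<Rightarrow> 'f::idom) set)"
proof -
  have "zero_set n {1} = ({} :: (index \<Rightarrow> 'f) set)"
    by (simp add: zero_set_def poly_eval_def monomial_eval_def)
  moreover have "indeterminates (1 :: (index, 'f) mpolynomial) = {}"
    by (simp add: indeterminates_def)
  ultimately have "zariski_closed n ({} :: (index \<Rightarrow> 'f) set)"
    unfolding zariski_closed_def by (intro exI[of _ "{1}"]) simp
  then have "openin (zariski_topology n) (affine_space n :: (index \<Rightarrow> 'f) set)"
    by (simp add: openin_zariski)
  then show ?thesis
    using openin_zariski[of n "topspace (zariski_topology n)"] openin_subset by blast
qed

lemma closedin_zariski: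
  fixes Z :: "(index \<Rightarrow> 'f::idom) set"
  shows "closedin (zariski_topology n) Z \<longleftrightarrow> zariski_closed n Z"
proof -
  have "Z \<subseteq> affine_space n" if "zariski_closed n Z"
    using that unfolding zariski_closed_def zero_set_def by blast
  then show ?thesis
    unfolding closedin_def topspace_zariski openin_zariski
    by (metis Diff_subset double_diff subset_refl)
qed


section \<open>Algebras and structure vectors\<close>

definition ordered_basis :: "('f::field \<Rightarrow> 'v::ab_group_add \<Rightarrow> 'v) \<Rightarrow> nat \<Rightarrow> (nat \<Rightarrow> 'v) \<Rightarrow> bool"
  where "ordered_basis scale n b \<longleftrightarrow> vector_space scale \<and> inj_on b {..<n} \<and>
    \<not> module.dependent scale (b ` {..<n}) \<and> module.span scale (b ` {..<n}) = UNIV"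

definition nonassoc_algebra ::
    "('f::field \<Rightarrow> 'v::ab_group_add \<Rightarrow> 'v) \<Rightarrow> nat \<Rightarrow> ('v \<Rightarrow> 'v \<Rightarrow> 'v) \<Rightarrow> bool"
  where "nonassoc_algebra scale n bracket \<longleftrightarrow> (\<exists>b. ordered_basis scale n b) \<and>
    (\<forall>x. Vector_Spaces.linear scale scale (\<lambda>y. bracket x y)) \<and>
    (\<forall>y. Vector_Spaces.linear scale scale (\<lambda>x. bracket x y))"

definition algebra_isomorphic ::
    "('f::field \<Rightarrow> 'v::ab_group_add \<Rightarrow> 'v) \<Rightarrow> ('v \<Rightarrow> 'v \<Rightarrow> 'v) \<Rightarrow>
     ('f \<Rightarrow> 'w::ab_group_add \<Rightarrow> 'w) \<Rightarrow> ('w \<Rightarrow> 'w \<Rightarrow> 'w) \<Rightarrow> bool"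
  where "algebra_isomorphic scale1 bracket1 scale2 bracket2 \<longleftrightarrow>
    (\<exists>f. Vector_Spaces.linear scale1 scale2 f \<and> bij f \<and>
         (\<forall>x y. f (bracket1 x y) = bracket2 (f x) (f y)))"

definition coordinate ::
    "('f::field \<Rightarrow> 'v::ab_group_add \<Rightarrow> 'v) \<Rightarrow> nat \<Rightarrow> (nat \<Rightarrow> 'v) \<Rightarrow> 'v \<Rightarrow> nat \<Rightarrow> 'f"
  where "coordinate scale n b x i = module.representation scale (b ` {..<n}) x (b i)"

definition structure_vector ::
    "('f::field \<Rightarrow> 'v::ab_group_add \<Rightarrow> 'v) \<Rightarrow> nat \<Rightarrow> (nat \<Rightarrow> 'v) \<Rightarrow> ('v \<Rightarrow> 'v \<Rightarrow> 'v) \<Rightarrow> index \<Rightarrow> 'f"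
  where "structure_vector scale n b bracket =
    (\<lambda>(i, j, k)\<in>indices n. coordinate scale n b (bracket (b i) (b j)) k)"

definition structure_vectors ::
    "('f::field \<Rightarrow> 'v::ab_group_add \<Rightarrow> 'v) \<Rightarrow> nat \<Rightarrow> ('v \<Rightarrow> 'v \<Rightarrow> 'v) \<Rightarrow> (index \<Rightarrow> 'f) set"
  where "structure_vectors scale n bracket =
    {structure_vector scale n b bracket |b. ordered_basis scale n b}"

text \<open>The bilinear product with \<open>[b i, b j] = t i j\<close>.\<close>

definition bilinear_extension ::
    "('f::field \<Rightarrow> 'v::ab_group_add \<Rightarrow> 'v) \<Rightarrow> nat \<Rightarrow> (nat \<Rightarrow> 'v) \<Rightarrow> (nat \<Rightarrow> nat \<Rightarrow> 'v) \<Rightarrow> 'v \<Rightarrow> 'v \<Rightarrow> 'v"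
  where "bilinear_extension scale n b t x y =
    (\<Sum>i<n. \<Sum>j<n. scale (coordinate scale n b x i * coordinate scale n b y j) (t i j))"


section \<open>Action of the general linear group and degeneration\<close>

definition algebra_of_vector ::
    "('f::field \<Rightarrow> 'v::ab_group_add \<Rightarrow> 'v) \<Rightarrow> nat \<Rightarrow> (nat \<Rightarrow> 'v) \<Rightarrow> (index \<Rightarrow> 'f) \<Rightarrow> 'v \<Rightarrow> 'v \<Rightarrow> 'v"
  where "algebra_of_vector scale n b l =
    bilinear_extension scale n b (\<lambda>i j. \<Sum>k<n. scale (l (i, j, k)) (b k))"

definition general_linear :: "nat \<Rightarrow> 'f::field mat set"
  where "general_linear n = {g \<in> carrier_mat n n. invertible_mat g}"

definition change_basis ::
    "('f::field \<Rightarrow> 'v::ab_group_add \<Rightarrow> 'v) \<Rightarrow> nat \<Rightarrow> (nat \<Rightarrow> 'v) \<Rightarrow> 'f mat \<Rightarrow> nat \<Rightarrow> 'v"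
  where "change_basis scale n b g j = (\<Sum>i<n. scale (g $$ (i, j)) (b i))"

text \<open>The reference space with its ordered basis \<open>v\<close> enters the action, but the resulting
  vector \<open>l g\<close> does not depend on its choice.\<close>

definition act ::
    "('f::field \<Rightarrow> 'v::ab_group_add \<Rightarrow> 'v) \<Rightarrow> nat \<Rightarrow> (nat \<Rightarrow> 'v) \<Rightarrow> (index \<Rightarrow> 'f) \<Rightarrow> 'f mat \<Rightarrow> index \<Rightarrow> 'f"
  where "act scale n v l g =
    structure_vector scale n (change_basis scale n v g) (algebra_of_vector scale n v l)"

definition orbit ::
    "('f::field \<Rightarrow> 'v::ab_group_add \<Rightarrow> 'v) \<Rightarrow> nat \<Rightarrow> (nat \<Rightarrow> 'v) \<Rightarrow> (index \<Rightarrow> 'f) \<Rightarrow> (index \<Rightarrow> 'f) set"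
  where "orbit scale n v l = {act scale n v l g |g. g \<in> general_linear n}"

text \<open>\<open>scale\<close> and \<open>v\<close> describe the reference space; the two algebras may live on other spaces.\<close>

definition properly_degenerates ::
    "('f::field \<Rightarrow> 'v::ab_group_add \<Rightarrow> 'v) \<Rightarrow> nat \<Rightarrow> (nat \<Rightarrow> 'v) \<Rightarrow>
     ('f \<Rightarrow> 'w1::ab_group_add \<Rightarrow> 'w1) \<Rightarrow> ('w1 \<Rightarrow> 'w1 \<Rightarrow> 'w1) \<Rightarrow>
     ('f \<Rightarrow> 'w2::ab_group_add \<Rightarrow> 'w2) \<Rightarrow> ('w2 \<Rightarrow> 'w2 \<Rightarrow> 'w2) \<Rightarrow> bool"
  where "properly_degenerates scale n v scale1 bracket1 scale2 bracket2 \<longleftrightarrow>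
    (\<exists>l1 \<in> structure_vectors scale1 n bracket1. \<exists>l2 \<in> structure_vectors scale2 n bracket2.
       l2 \<in> (zariski_topology n closure_of orbit scale n v l1) - orbit scale n v l1)"


section \<open>The algebras a_n, r_n and h_n\<close>

definition a_algebra :: "'v \<Rightarrow> 'v \<Rightarrow> 'v::ab_group_add"
  where "a_algebra x y = 0"

definition r_algebra ::
    "('f::field \<Rightarrow> 'v::ab_group_add \<Rightarrow> 'v) \<Rightarrow> nat \<Rightarrow> (nat \<Rightarrow> 'v) \<Rightarrow> 'v \<Rightarrow> 'v \<Rightarrow> 'v"
  where "r_algebra scale n v = bilinear_extension scale n v (\<lambda>i j.
    if i < n - 1 \<and> j = n - 1 then v i
    else if i = n - 1 \<and> j < n - 1 then - v j
    else 0)"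

definition h_algebra ::
    "('f::field \<Rightarrow> 'v::ab_group_add \<Rightarrow> 'v) \<Rightarrow> nat \<Rightarrow> (nat \<Rightarrow> 'v) \<Rightarrow> 'v \<Rightarrow> 'v \<Rightarrow> 'v"
  where "h_algebra scale n v = bilinear_extension scale n v (\<lambda>i j.
    if i = 0 \<and> j = 1 then v 2
    else if i = 1 \<and> j = 0 then - v 2
    else 0)"

end

(* Scaling a basis by powers of t turns a structure vector into a curve of structure vectors of the
   same algebra; over an infinite field the constant term of such a polynomial curve lies in the
   closure of the orbit. If some [x, y] lies outside span {x, y}, weight 1 on x, y and weight 2 on
   the rest of a basis x, y, [x, y], ... makes the curve end at h_n. Otherwise
   [x, y] = f(y) x - f(x) y for a linear form f, so the algebra is a_n or r_n.
   Conversely, products of this form and products (p(x) q(y) - p(y) q(x)) r with p(r) = q(r) = 0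
   form two Zariski closed sets, which are the orbit of r_n, respectively h_n, together with 0. *)

theory Submission
  imports Defs "HOL-Computational_Algebra.Polynomial"
begin

section \<open>Zariski closures\<close>

text \<open>Since the field need not be algebraically closed, no dimension theory of orbits is used:
  explicit curves put vectors into a closure, and explicit equations keep vectors out of it. The
  equations may only mention structure constants, so the data f, or p, q, r, must first be recovered
  from the entries of a vector. Matrices disappear early. The sets of structure vectors of two
  algebras are equal if the algebras are isomorphic and disjoint otherwise, so an orbit is such a
  set, and membership of one normal form decides isomorphism. The condition p(r) = q(r) = 0 is what
  leaves a single nonzero orbit: without it the second family would also contain the product with
  [v_1, v_2] = v_2, in which [v_1, v_2] is not central, as it is in h_n. The condition survives a
  change of basis because it speaks of linear forms and a vector, not of coordinates. Characteristic
  2 is allowed, so [x, x] = 0 is used in its own right and not only through antisymmetry.\<close>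

lemma poly_eval_along_curve:
  fixes p :: "('x, 'f::idom) mpolynomial" and c :: "'x \<Rightarrow> 'f poly"
  obtains q where "\<And>t. poly q t = poly_eval p (\<lambda>i. poly (c i) t)"
proof
  show "poly (\<Sum>m\<in>Poly_Mapping.keys p. smult (Poly_Mapping.lookup p m)
      (\<Prod>i\<in>Poly_Mapping.keys m. c i ^ Poly_Mapping.lookup m i)) t
    = poly_eval p (\<lambda>i. poly (c i) t)" for t
    by (simp add: poly_eval_def monomial_eval_def poly_sum poly_prod)
qed

text \<open>A basic polynomial that does not vanish at the limit pulls back to a nonzero polynomial
  in \<open>t\<close>. This has finitely many roots, so over an infinite field some \<open>t\<close>
  other than 0 avoids them, and every neighbourhood of the limit meets \<open>Y\<close>.\<close>

lemma curve_limit_in_closure: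
  fixes c :: "index \<Rightarrow> 'f::field poly"
  assumes inf: "infinite (UNIV :: 'f set)"
    and Y: "\<And>t. t \<noteq> 0 \<Longrightarrow> (\<lambda>i\<in>indices n. poly (c i) t) \<in> Y"
  shows "(\<lambda>i\<in>indices n. poly (c i) 0) \<in> zariski_topology n closure_of Y"
proof -
  define l where "l t = (\<lambda>i\<in>indices n. poly (c i) t)" for t
  have l_affine: "l t \<in> affine_space n" for t
    by (simp add: l_def affine_space_def)
  have "\<exists>y. y \<in> Y \<and> y \<in> T" if "l 0 \<in> T" "openin (zariski_topology n) T" for T
  proof -
    obtain S where S: "affine_space n - T = zero_set n S"
      using \<open>openin _ T\<close> unfolding openin_zariski zariski_closed_def by blast
    then obtain p where "p \<in> S" "poly_eval p (l 0) \<noteq> 0"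
      using \<open>l 0 \<in> T\<close> l_affine unfolding zero_set_def by blast
    \<comment> \<open>Points of the affine space take the value \<open>undefined\<close> off
      \<open>indices n\<close>; constant polynomials with that value make the whole point a
      polynomial curve.\<close>
    define d where "d = (\<lambda>i. if i \<in> indices n then c i else [:undefined:])"
    have l: "l t = (\<lambda>i. poly (d i) t)" for t
      by (auto simp: l_def d_def)
    obtain q where q: "poly q t = poly_eval p (l t)" for t
      unfolding l using poly_eval_along_curve[of p d] by blast
    have "q \<noteq> 0"
      using \<open>poly_eval p (l 0) \<noteq> 0\<close> q[of 0] by auto
    then have "finite (insert 0 {t. poly q t = 0})"
      by (simp add: poly_roots_finite)
    then obtain t where "t \<notin> insert 0 {t. poly q t = 0}"
      using ex_new_if_finite[OF inf] by blast
    then have "t \<noteq> 0" "poly_eval p (l t) \<noteq> 0"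
      using q by auto
    then have "l t \<in> T"
      using S \<open>p \<in> S\<close> l_affine unfolding zero_set_def by blast
    then show ?thesis
      using Y[OF \<open>t \<noteq> 0\<close>] unfolding l_def by blast
  qed
  then show ?thesis
    using l_affine unfolding in_closure_of l_def by simp
qed

section \<open>Polynomial functions and their closed zero loci\<close>

definition polynomial_function :: "nat \<Rightarrow> ((index \<Rightarrow> 'f::comm_semiring_1) \<Rightarrow> 'f) \<Rightarrow> bool"
  where "polynomial_function n f \<longleftrightarrow>
    (\<exists>p. indeterminates p \<subseteq> indices n \<and> (\<forall>x. poly_eval p x = f x))"

named_theorems polynomial_intros

lemma polynomial_function_const [polynomial_intros]: "polynomial_function n (\<lambda>x. c)"
  unfolding polynomial_function_def
  by (rule exI[of _ "Poly_Mapping.single 0 c"]) (auto simp: indeterminates_def monomial_eval_def)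

lemma polynomial_function_coordinate [polynomial_intros]:
  assumes "i \<in> indices n"
  shows "polynomial_function n (\<lambda>x. x i)"
  unfolding polynomial_function_def using assms
  by (intro exI[of _ "Poly_Mapping.single (Poly_Mapping.single i 1) 1"])
     (auto simp: indeterminates_def monomial_eval_def)

lemma polynomial_function_add [polynomial_intros]:
  assumes "polynomial_function n f" "polynomial_function n g"
  shows "polynomial_function n (\<lambda>x. f x + g x)"
proof -
  obtain p q where "indeterminates p \<subseteq> indices n" "\<And>x. poly_eval p x = f x"
    "indeterminates q \<subseteq> indices n" "\<And>x. poly_eval q x = g x"
    using assms unfolding polynomial_function_def by blast
  moreover have "indeterminates (p + q) \<subseteq> indeterminates p \<union> indeterminates q"
    using Poly_Mapping.keys_add[of p q] unfolding indeterminates_def by auto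
  ultimately show ?thesis
    unfolding polynomial_function_def by (intro exI[of _ "p + q"]) (auto simp: poly_eval_add)
qed

lemma polynomial_function_mult [polynomial_intros]:
  assumes "polynomial_function n f" "polynomial_function n g"
  shows "polynomial_function n (\<lambda>x. f x * g x)"
proof -
  obtain p q where "indeterminates p \<subseteq> indices n" "\<And>x. poly_eval p x = f x"
    "indeterminates q \<subseteq> indices n" "\<And>x. poly_eval q x = g x"
    using assms unfolding polynomial_function_def by blast
  then show ?thesis
    using indeterminates_mult[of p q]
    unfolding polynomial_function_def by (intro exI[of _ "p * q"]) (auto simp: poly_eval_mult)
qed

lemma polynomial_function_diff [polynomial_intros]:
  fixes f :: "(index \<Rightarrow> 'f::comm_ring_1) \<Rightarrow> 'f"
  assumes "polynomial_function n f" "polynomial_function n g"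
  shows "polynomial_function n (\<lambda>x. f x - g x)"
  using polynomial_function_add[OF assms(1)
      polynomial_function_mult[OF polynomial_function_const[of n "- 1"] assms(2)]]
  by simp

lemma polynomial_function_sum [polynomial_intros]:
  assumes "\<And>k. k \<in> A \<Longrightarrow> polynomial_function n (f k)"
  shows "polynomial_function n (\<lambda>x. \<Sum>k\<in>A. f k x)"
  using assms
  by (induction A rule: infinite_finite_induct) (auto intro!: polynomial_intros)

lemma polynomial_function_if [polynomial_intros]:
  assumes "P \<Longrightarrow> polynomial_function n f" "\<not> P \<Longrightarrow> polynomial_function n g"
  shows "polynomial_function n (\<lambda>x. if P then f x else g x)"
  using assms by (cases P) simp_all

text \<open>Lets equations be written as plain functions of the point; that they are polynomial then
  follows from their shape by \<open>polynomial_intros\<close>.\<close>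

lemma closedin_zero_locus:
  fixes F :: "((index \<Rightarrow> 'f::idom) \<Rightarrow> 'f) set"
  assumes "\<And>f. f \<in> F \<Longrightarrow> polynomial_function n f"
  shows "closedin (zariski_topology n) {x \<in> affine_space n. \<forall>f\<in>F. f x = 0}"
proof -
  obtain p where p: "\<And>f. f \<in> F \<Longrightarrow> indeterminates (p f) \<subseteq> indices n \<and> (\<forall>x. poly_eval (p f) x = f x)"
    using assms unfolding polynomial_function_def by metis
  then have "{x \<in> affine_space n. \<forall>f\<in>F. f x = 0} = zero_set n (p ` F)"
    by (auto simp: zero_set_def)
  then show ?thesis
    unfolding closedin_zariski zariski_closed_def using p by (intro exI[of _ "p ` F"]) auto
qed

section \<open>Coordinates\<close>

text \<open>The basis is a parameter, so that two bases of one space, or bases of two spaces, can be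
  interpreted side by side. The library knows bases as sets; \<open>inj\<close> ensures that the
  family lists this set without repetition.\<close>

locale based_space = finite_dimensional_vector_space scale "b ` {..<n}"
  for scale :: "'f::field \<Rightarrow> 'v::ab_group_add \<Rightarrow> 'v" and n :: nat and b :: "nat \<Rightarrow> 'v" +
  assumes inj: "inj_on b {..<n}"
begin

abbreviation "coord \<equiv> coordinate scale n b"

lemma ordered_basis: "ordered_basis scale n b"
  unfolding ordered_basis_def using vector_space_axioms inj independent_Basis span_Basis by simp

lemma sum_coordinate: "(\<Sum>i<n. scale (coord x i) (b i)) = x"
  using sum_representation_eq[of "b ` {..<n}" x "b ` {..<n}"] inj independent_Basis span_Basis
  by (simp add: coordinate_def sum.reindex)

lemma coordinate_basis: "i < n \<Longrightarrow> j < n \<Longrightarrow> coord (b i) j = (if j = i then 1 else 0)"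
  using inj by (auto simp: coordinate_def representation_basis independent_Basis inj_on_eq_iff)

lemma coordinate_add: "coord (x + y) i = coord x i + coord y i"
  by (simp add: coordinate_def representation_add independent_Basis span_Basis)

lemma coordinate_diff: "coord (x - y) i = coord x i - coord y i"
  by (simp add: coordinate_def representation_diff independent_Basis span_Basis)

lemma coordinate_minus: "coord (- x) i = - coord x i"
  by (simp add: coordinate_def representation_neg independent_Basis span_Basis)

lemma coordinate_scale: "coord (scale a x) i = a * coord x i"
  by (simp add: coordinate_def representation_scale independent_Basis span_Basis)

lemma coordinate_zero: "coord 0 i = 0"
  by (simp add: coordinate_def representation_zero)

lemma coordinate_sum: "coord (\<Sum>k\<in>A. f k) i = (\<Sum>k\<in>A. coord (f k) i)"
  by (simp add: coordinate_def representation_sum independent_Basis span_Basis)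

lemma coordinate_combination:
  "j < n \<Longrightarrow> coord (\<Sum>i<n. scale (a i) (b i)) j = a j"
  by (simp add: coordinate_sum coordinate_scale coordinate_basis if_distrib cong: if_cong)

lemma card_basis: "card (b ` {..<n}) = n"
  using inj by (simp add: card_image)

text \<open>Dimension count: vectors indexed below \<open>n\<close> that span a space of dimension
  \<open>n\<close> must be distinct and independent.\<close>

lemma ordered_basis_if_spanning:
  assumes "span (c ` {..<n}) = UNIV"
  shows "ordered_basis scale n c"
proof -
  have "dim (c ` {..<n}) = n"
    using dim_span[of "c ` {..<n}"] assms by (simp add: card_basis)
  then have "n \<le> card (c ` {..<n})"
    by (metis dim_le_card' finite_imageI finite_lessThan)
  then have card: "card (c ` {..<n}) = n"
    using card_image_le[of "{..<n}" c] by simp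
  then have "inj_on c {..<n}"
    by (simp add: eq_card_imp_inj_on)
  moreover have "independent (c ` {..<n})"
    by (rule card_le_dim_spanning[of _ UNIV]) (use assms card card_basis in auto)
  ultimately show ?thesis
    unfolding ordered_basis_def using assms vector_space_axioms by simp
qed

lemma ordered_basis_if_generates:
  assumes "\<And>i. i < n \<Longrightarrow> b i \<in> span (c ` {..<n})"
  shows "ordered_basis scale n c"
proof (rule ordered_basis_if_spanning)
  have "b ` {..<n} \<subseteq> span (c ` {..<n})"
    using assms by auto
  then show "span (c ` {..<n}) = UNIV"
    using span_Basis span_minimal[OF _ subspace_span] by blast
qed

text \<open>Adapted bases are found as sets, by extending independent sets, whereas structure
  vectors need an order. The positions outside \<open>I\<close> are filled by an arbitrary
  bijection, the cardinalities being equal.\<close>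

lemma ordered_basis_of_set:
  assumes "independent B" "span B = UNIV" "I \<subseteq> {..<n}" "inj_on g I" "g ` I \<subseteq> B"
  obtains c where "ordered_basis scale n c" "c ` {..<n} = B" "\<And>i. i \<in> I \<Longrightarrow> c i = g i"
proof -
  have B: "finite B" "card B = n"
    using assms dim_eq_card[of B UNIV] card_basis by (auto simp: finiteI_independent)
  have I: "finite I"
    using assms(3) finite_subset by blast
  have "card ({..<n} - I) = card (B - g ` I)"
    using B I assms by (simp add: card_Diff_subset card_image)
  then obtain h where h: "bij_betw h ({..<n} - I) (B - g ` I)"
    using B by (meson bij_betw_iff_card finite_Diff finite_lessThan)
  define c where "c i = (if i \<in> I then g i else h i)" for i
  have "bij_betw c I (g ` I)"
    using assms(4) by (auto simp: bij_betw_def c_def inj_on_def)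
  moreover have "bij_betw c ({..<n} - I) (B - g ` I)"
    using h by (rule bij_betw_cong[THEN iffD1, rotated]) (simp add: c_def)
  ultimately have "bij_betw c (I \<union> ({..<n} - I)) (g ` I \<union> (B - g ` I))"
    by (rule bij_betw_combine) auto
  then have "bij_betw c {..<n} B"
    using assms(3,5) by (simp add: Un_absorb1)
  then have c: "c ` {..<n} = B"
    by (simp add: bij_betw_def)
  show thesis
    by (rule that[OF ordered_basis_if_spanning c]) (use c assms(2) in \<open>auto simp: c_def\<close>)
qed

lemma structure_vector_combination:
  assumes "i < n" "j < n"
  shows "(\<Sum>k<n. scale (structure_vector scale n b br (i, j, k)) (b k)) = br (b i) (b j)"
proof -
  have "(\<Sum>k<n. scale (structure_vector scale n b br (i, j, k)) (b k))
    = (\<Sum>k<n. scale (coord (br (b i) (b j)) k) (b k))"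
    using assms by (intro sum.cong) (auto simp: structure_vector_def indices_def)
  then show ?thesis
    by (simp add: sum_coordinate)
qed

lemma structure_vector_eqI:
  assumes "l \<in> affine_space n"
    and "\<And>i j. i < n \<Longrightarrow> j < n \<Longrightarrow> br (b i) (b j) = (\<Sum>k<n. scale (l (i, j, k)) (b k))"
  shows "structure_vector scale n b br = l"
proof
  fix x :: index
  obtain i j k where x: "x = (i, j, k)" by (cases x)
  show "structure_vector scale n b br x = l x"
    using assms unfolding x structure_vector_def affine_space_def
    by (auto simp: indices_def PiE_def extensional_def coordinate_combination)
qed

end

lemma based_space_iff: "based_space scale n b \<longleftrightarrow> ordered_basis scale n b"
proof
  assume "ordered_basis scale n b"
  then interpret vector_space scale
    by (simp add: ordered_basis_def)
  show "based_space scale n b"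
    using \<open>ordered_basis scale n b\<close> by unfold_locales (auto simp: ordered_basis_def)
qed (rule based_space.ordered_basis)

section \<open>Isomorphism classes and orbits\<close>

context based_space
begin

lemma bracket_expand:
  assumes "nonassoc_algebra scale n br"
  shows "br x y = (\<Sum>i<n. \<Sum>j<n. scale (coord x i * coord y j) (br (b i) (b j)))"
proof -
  have lin: "Vector_Spaces.linear scale scale (br x)" "Vector_Spaces.linear scale scale (\<lambda>x. br x y)" for x y
    using assms by (auto simp: nonassoc_algebra_def)
  have right: "br x y = (\<Sum>j<n. scale (coord y j) (br x (b j)))" for x y
  proof -
    interpret R: Vector_Spaces.linear scale scale "br x" by (rule lin)
    show ?thesis
      by (subst sum_coordinate[of y, symmetric]) (simp only: R.sum R.scale)
  qed
  have left: "br x y = (\<Sum>i<n. scale (coord x i) (br (b i) y))" for x y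
  proof -
    interpret L: Vector_Spaces.linear scale scale "\<lambda>x. br x y" by (rule lin)
    show ?thesis
      by (subst sum_coordinate[of x, symmetric]) (simp only: L.sum L.scale)
  qed
  show ?thesis
    by (subst left, subst right) (simp add: scale_sum_right)
qed

lemma nonassoc_algebra_bilinear_extension: "nonassoc_algebra scale n (bilinear_extension scale n b t)"
proof -
  let ?B = "bilinear_extension scale n b t"
  have "?B (x + y) z = ?B x z + ?B y z" "?B z (x + y) = ?B z x + ?B z y"
    "?B (scale a x) z = scale a (?B x z)" "?B z (scale a x) = scale a (?B z x)" for a x y z
    by (simp_all add: bilinear_extension_def coordinate_add coordinate_scale scale_left_distrib
        distrib_left distrib_right sum.distrib scale_sum_right mult.assoc mult.left_commute)
  then show ?thesis
    unfolding nonassoc_algebra_def Vector_Spaces.linear_iff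
    using ordered_basis vector_space_axioms by blast
qed

lemma bilinear_extension_basis:
  assumes "i < n" "j < n"
  shows "bilinear_extension scale n b t (b i) (b j) = t i j"
proof -
  have "bilinear_extension scale n b t (b i) (b j)
    = (\<Sum>i'<n. \<Sum>j'<n. if i' = i then if j' = j then t i' j' else 0 else 0)"
    unfolding bilinear_extension_def
    by (intro sum.cong refl) (auto simp: coordinate_basis assms)
  also have "\<dots> = (\<Sum>i'<n. if i' = i then \<Sum>j'<n. if j' = j then t i' j' else 0 else 0)"
    by (intro sum.cong refl) auto
  also have "\<dots> = t i j"
    using assms by simp
  finally show ?thesis .
qed

lemma structure_vector_bilinear_extension:
  assumes "\<And>i j. i < n \<Longrightarrow> j < n \<Longrightarrow> t i j = (\<Sum>k<n. scale (l (i, j, k)) (b k))"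
    and "l \<in> affine_space n"
  shows "structure_vector scale n b (bilinear_extension scale n b t) = l"
  using assms by (intro structure_vector_eqI) (simp_all add: bilinear_extension_basis)

lemma structure_vector_in_structure_vectors:
  "structure_vector scale n b br \<in> structure_vectors scale n br"
  unfolding structure_vectors_def using ordered_basis by blast

text \<open>A basis is a function on all naturals of which only the values below \<open>n\<close>
  count; a matrix can reproduce a given basis only there.\<close>

lemma structure_vector_cong:
  assumes "\<And>i. i < n \<Longrightarrow> c i = b i"
  shows "structure_vector scale n c br = structure_vector scale n b br"
proof -
  have "c ` {..<n} = b ` {..<n}"
    using assms by auto
  then show ?thesis
    unfolding structure_vector_def coordinate_def
    by (intro restrict_ext) (auto simp: indices_def assms)
qed

text \<open>The product of the two matrices expands \<open>b k\<close> in the basis \<open>c\<close>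
  and the result again in \<open>b\<close>. With the roles of the bases exchanged this gives the
  other one-sided inverse.\<close>

lemma change_basis_inverse:
  assumes "ordered_basis scale n c"
  shows "mat n n (\<lambda>(i, j). coord (c j) i) * mat n n (\<lambda>(i, j). coordinate scale n c (b j) i) = 1\<^sub>m n"
proof -
  interpret C: based_space scale n c
    using assms by (simp add: based_space_iff)
  have "(\<Sum>j<n. coord (c j) i * C.coord (b k) j) = (if i = k then 1 else 0)" if "i < n" "k < n" for i k
  proof -
    have "(\<Sum>j<n. coord (c j) i * C.coord (b k) j) = coord (\<Sum>j<n. scale (C.coord (b k) j) (c j)) i"
      by (simp add: coordinate_sum coordinate_scale mult.commute)
    then show ?thesis
      using that by (simp add: C.sum_coordinate coordinate_basis)
  qed
  then show ?thesis
    by (intro eq_matI) (auto simp: scalar_prod_def lessThan_atLeast0)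
qed

end

section \<open>The action of the general linear group\<close>

lemma nonassoc_algebra_of_vector:
  assumes "ordered_basis scale n b"
  shows "nonassoc_algebra scale n (algebra_of_vector scale n b l)"
proof -
  interpret based_space scale n b using assms by (simp add: based_space_iff)
  show ?thesis
    unfolding algebra_of_vector_def by (rule nonassoc_algebra_bilinear_extension)
qed

lemma structure_vector_algebra_of_vector:
  assumes "ordered_basis scale n b" "l \<in> affine_space n"
  shows "structure_vector scale n b (algebra_of_vector scale n b l) = l"
proof -
  interpret based_space scale n b using assms by (simp add: based_space_iff)
  show ?thesis
    unfolding algebra_of_vector_def using assms(2)
    by (intro structure_vector_bilinear_extension) simp_all
qed

text \<open>The columns of an inverse matrix express each old basis vector through the new family,
  which therefore spans.\<close>

lemma ordered_basis_change_basis: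
  assumes b: "ordered_basis scale n b" and g: "g \<in> general_linear n"
  shows "ordered_basis scale n (change_basis scale n b g)"
proof -
  interpret based_space scale n b using b by (simp add: based_space_iff)
  let ?c = "change_basis scale n b g"
  obtain h where gh: "g \<in> carrier_mat n n" "g * h = 1\<^sub>m n" "h * g = 1\<^sub>m (dim_row h)"
    using g by (auto simp: general_linear_def invertible_mat_def inverts_mat_def)
  have h: "h \<in> carrier_mat n n"
    using gh by (metis carrier_matD(2) carrier_matI index_mult_mat(3) index_one_mat(3))
  have "b k \<in> span (?c ` {..<n})" if "k < n" for k
  proof -
    have gh_entry: "(\<Sum>j<n. g $$ (i, j) * h $$ (j, k)) = (if i = k then 1 else 0)" if "i < n" for i
    proof -
      have "(g * h) $$ (i, k) = (\<Sum>j<n. g $$ (i, j) * h $$ (j, k))"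
        using gh(1) h \<open>i < n\<close> \<open>k < n\<close> by (simp add: scalar_prod_def lessThan_atLeast0)
      then show ?thesis
        unfolding gh(2) using \<open>i < n\<close> \<open>k < n\<close> by simp
    qed
    have "b k = (\<Sum>i<n. if i = k then b i else 0)"
      using \<open>k < n\<close> by simp
    also have "\<dots> = (\<Sum>i<n. scale (\<Sum>j<n. g $$ (i, j) * h $$ (j, k)) (b i))"
      by (intro sum.cong refl) (simp add: gh_entry)
    also have "\<dots> = (\<Sum>i<n. \<Sum>j<n. scale (h $$ (j, k)) (scale (g $$ (i, j)) (b i)))"
      by (simp add: scale_sum_left mult.commute)
    also have "\<dots> = (\<Sum>j<n. scale (h $$ (j, k)) (?c j))"
      by (subst sum.swap) (simp add: change_basis_def scale_sum_right)
    also have "\<dots> \<in> span (?c ` {..<n})"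
      by (intro span_sum span_scale span_base) auto
    finally show ?thesis .
  qed
  then show ?thesis
    by (rule ordered_basis_if_generates)
qed

lemma change_basis_surj:
  assumes b: "ordered_basis scale n b" and c: "ordered_basis scale n c"
  obtains g where "g \<in> general_linear n" "\<And>j. j < n \<Longrightarrow> change_basis scale n b g j = c j"
proof -
  interpret B: based_space scale n b using b by (simp add: based_space_iff)
  interpret C: based_space scale n c using c by (simp add: based_space_iff)
  define g where "g = mat n n (\<lambda>(i, j). B.coord (c j) i)"
  define h where "h = mat n n (\<lambda>(i, j). C.coord (b j) i)"
  have "g * h = 1\<^sub>m (dim_row g)" "h * g = 1\<^sub>m (dim_row h)"
    unfolding g_def h_def dim_row_mat by (rule B.change_basis_inverse[OF c] C.change_basis_inverse[OF b])+
  then have "invertible_mat g"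
    unfolding invertible_mat_def inverts_mat_def by (intro conjI exI[of _ h]) (simp_all add: g_def)
  then have "g \<in> general_linear n"
    by (simp add: general_linear_def g_def)
  moreover have "change_basis scale n b g j = c j" if "j < n" for j
    using that B.sum_coordinate[of "c j"] by (simp add: change_basis_def g_def)
  ultimately show thesis by (rule that)
qed

text \<open>Invertible matrices applied to \<open>b\<close> yield exactly the ordered bases, up to
  values from \<open>n\<close> on. From here on the action can be forgotten.\<close>

lemma orbit_eq_structure_vectors:
  assumes b: "ordered_basis scale n b"
  shows "orbit scale n b l = structure_vectors scale n (algebra_of_vector scale n b l)"
proof
  show "orbit scale n b l \<subseteq> structure_vectors scale n (algebra_of_vector scale n b l)"
    unfolding orbit_def act_def structure_vectors_def
    using ordered_basis_change_basis[OF b] by blast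
  show "structure_vectors scale n (algebra_of_vector scale n b l) \<subseteq> orbit scale n b l"
  proof
    fix m assume "m \<in> structure_vectors scale n (algebra_of_vector scale n b l)"
    then obtain c where c: "ordered_basis scale n c"
      and m: "m = structure_vector scale n c (algebra_of_vector scale n b l)"
      unfolding structure_vectors_def by blast
    interpret C: based_space scale n c using c by (simp add: based_space_iff)
    obtain g where g: "g \<in> general_linear n" "\<And>j. j < n \<Longrightarrow> change_basis scale n b g j = c j"
      using change_basis_surj[OF b c] by blast
    have "m = act scale n b l g"
      unfolding m act_def using g(2) by (rule C.structure_vector_cong[symmetric])
    then show "m \<in> orbit scale n b l"
      unfolding orbit_def using g(1) by blast
  qed
qed

section \<open>Isomorphism in terms of structure vectors\<close>

lemma algebra_isomorphic_sym:
  assumes "algebra_isomorphic scale1 br1 scale2 br2"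
  shows "algebra_isomorphic scale2 br2 scale1 br1"
proof -
  obtain f where f: "Vector_Spaces.linear scale1 scale2 f" "bij f"
      "\<And>x y. f (br1 x y) = br2 (f x) (f y)"
    using assms unfolding algebra_isomorphic_def by blast
  define g where "g = inv_into UNIV f"
  have inv: "f (g x) = x" "g (f y) = y" for x y
    using \<open>bij f\<close> by (simp_all add: g_def bij_is_surj bij_is_inj surj_f_inv_f)
  have "bij g"
    unfolding g_def using \<open>bij f\<close> by (rule bij_imp_bij_inv)
  have "Vector_Spaces.linear scale2 scale1 (g)"
    using f(1) unfolding Vector_Spaces.linear_iff by (metis inv)
  moreover have "g (br2 x y) = br1 (g x) (g y)" for x y
    by (metis f(3) inv)
  ultimately show ?thesis
    unfolding algebra_isomorphic_def using \<open>bij g\<close> by blast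
qed

lemma structure_vectors_mono_isomorphic:
  assumes "algebra_isomorphic scale1 br1 scale2 br2"
  shows "structure_vectors scale1 n br1 \<subseteq> structure_vectors scale2 n br2"
proof
  fix l assume "l \<in> structure_vectors scale1 n br1"
  then obtain b where b: "ordered_basis scale1 n b" and l: "l = structure_vector scale1 n b br1"
    unfolding structure_vectors_def by blast
  interpret B: based_space scale1 n b using b by (simp add: based_space_iff)
  obtain f where f: "Vector_Spaces.linear scale1 scale2 f" "bij f"
      "\<And>x y. f (br1 x y) = br2 (f x) (f y)"
    using assms unfolding algebra_isomorphic_def by blast
  interpret f: Vector_Spaces.linear scale1 scale2 f by (rule f)
  interpret vector_space_pair scale1 scale2 by unfold_locales
  have img: "(f \<circ> b) ` {..<n} = f ` (b ` {..<n})"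
    by (simp add: image_comp)
  have "inj f"
    using \<open>bij f\<close> by (rule bij_is_inj)
  then have "inj_on (f \<circ> b) {..<n}"
    using B.inj by (auto intro: comp_inj_on inj_on_subset)
  moreover have "f.vs2.independent ((f \<circ> b) ` {..<n})"
    unfolding img using \<open>inj f\<close>
    by (intro linear_independent_injective_image f B.independent_Basis) (auto intro: inj_on_subset)
  moreover have "f.vs2.span ((f \<circ> b) ` {..<n}) = UNIV"
    unfolding img by (simp add: f.span_image B.span_Basis bij_is_surj[OF \<open>bij f\<close>])
  ultimately have c: "ordered_basis scale2 n (f \<circ> b)"
    unfolding ordered_basis_def using f.vs2.vector_space_axioms by blast
  interpret C: based_space scale2 n "f \<circ> b" using c by (simp add: based_space_iff)
  have "structure_vector scale2 n (f \<circ> b) br2 = l"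
  proof (rule C.structure_vector_eqI)
    show "l \<in> affine_space n"
      by (simp add: l structure_vector_def affine_space_def)
    fix i j assume "i < n" "j < n"
    then have "br1 (b i) (b j) = (\<Sum>k<n. scale1 (l (i, j, k)) (b k))"
      by (simp add: l B.structure_vector_combination)
    then have "f (br1 (b i) (b j)) = (\<Sum>k<n. scale2 (l (i, j, k)) (f (b k)))"
      by (simp add: f.sum f.scale)
    then show "br2 ((f \<circ> b) i) ((f \<circ> b) j) = (\<Sum>k<n. scale2 (l (i, j, k)) ((f \<circ> b) k))"
      by (simp add: f(3))
  qed
  then show "l \<in> structure_vectors scale2 n br2"
    using C.structure_vector_in_structure_vectors by blast
qed

lemma structure_vectors_isomorphic:
  assumes "algebra_isomorphic scale1 br1 scale2 br2"
  shows "structure_vectors scale1 n br1 = structure_vectors scale2 n br2"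
  using structure_vectors_mono_isomorphic[OF assms]
    structure_vectors_mono_isomorphic[OF algebra_isomorphic_sym[OF assms]] by blast

text \<open>The linear bijection matching the two bases respects products of basis vectors, hence
  all products by bilinearity. Together with \<open>structure_vectors_isomorphic\<close>, the sets
  of structure vectors of two algebras are either equal or disjoint.\<close>

lemma algebra_isomorphic_if_common_structure_vector:
  assumes alg: "nonassoc_algebra scale1 n br1" "nonassoc_algebra scale2 n br2"
    and l: "l \<in> structure_vectors scale1 n br1" "l \<in> structure_vectors scale2 n br2"
  shows "algebra_isomorphic scale1 br1 scale2 br2"
proof -
  obtain b where b: "ordered_basis scale1 n b" and lb: "l = structure_vector scale1 n b br1"
    using l(1) unfolding structure_vectors_def by blast
  obtain c where c: "ordered_basis scale2 n c" and lc: "l = structure_vector scale2 n c br2"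
    using l(2) unfolding structure_vectors_def by blast
  interpret B: based_space scale1 n b using b by (simp add: based_space_iff)
  interpret C: based_space scale2 n c using c by (simp add: based_space_iff)
  define f where "f x = (\<Sum>i<n. scale2 (B.coord x i) (c i))" for x
  define g where "g y = (\<Sum>i<n. scale1 (C.coord y i) (b i))" for y
  have "g (f x) = x" for x
    by (simp add: f_def g_def C.coordinate_combination B.sum_coordinate)
  moreover have "f (g y) = y" for y
    by (simp add: f_def g_def B.coordinate_combination C.sum_coordinate)
  ultimately have "bij f"
    by (intro bij_betw_byWitness[where f' = g]) auto
  have lin: "Vector_Spaces.linear scale1 scale2 f"
    unfolding Vector_Spaces.linear_iff f_def
    using B.vector_space_axioms C.vector_space_axioms
    by (auto simp: B.coordinate_add B.coordinate_scale C.scale_left_distrib sum.distrib C.scale_sum_right)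
  interpret f: Vector_Spaces.linear scale1 scale2 f by (rule lin)
  have f_basis: "f (br1 (b i) (b j)) = br2 (c i) (c j)" if "i < n" "j < n" for i j
  proof -
    have "f (br1 (b i) (b j)) = (\<Sum>k<n. scale2 (l (i, j, k)) (c k))"
      using that unfolding f_def lb by (intro sum.cong) (auto simp: structure_vector_def indices_def)
    then show ?thesis
      using that by (simp add: lc C.structure_vector_combination)
  qed
  have "f (br1 x y) = br2 (f x) (f y)" for x y
  proof -
    have coord: "C.coord (f x) i = B.coord x i" if "i < n" for x i
      using that by (simp add: f_def C.coordinate_combination)
    have "f (br1 x y) = (\<Sum>i<n. \<Sum>j<n. scale2 (B.coord x i * B.coord y j) (f (br1 (b i) (b j))))"
      by (subst B.bracket_expand[OF alg(1)]) (simp only: f.sum f.scale)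
    also have "\<dots> = (\<Sum>i<n. \<Sum>j<n. scale2 (C.coord (f x) i * C.coord (f y) j) (br2 (c i) (c j)))"
      by (intro sum.cong refl) (simp add: f_basis coord)
    also have "\<dots> = br2 (f x) (f y)"
      by (rule C.bracket_expand[OF alg(2), symmetric])
    finally show ?thesis .
  qed
  then show ?thesis
    unfolding algebra_isomorphic_def using lin \<open>bij f\<close> by blast
qed

text \<open>The orbit is computed in the reference space, while the algebra may live on another
  space of the same dimension. Both algebras have \<open>l\<close> as a structure vector, so they
  are isomorphic.\<close>

lemma orbit_structure_vector:
  assumes b: "ordered_basis scale n b" and alg: "nonassoc_algebra scale' n br"
    and l: "l \<in> structure_vectors scale' n br"
  shows "orbit scale n b l = structure_vectors scale' n br"
proof -
  interpret based_space scale n b using b by (simp add: based_space_iff)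
  have "l \<in> affine_space n"
    using l by (auto simp: structure_vectors_def structure_vector_def affine_space_def)
  then have "l \<in> structure_vectors scale n (algebra_of_vector scale n b l)"
    using structure_vector_in_structure_vectors structure_vector_algebra_of_vector[OF b] by metis
  then have "algebra_isomorphic scale (algebra_of_vector scale n b l) scale' br"
    using algebra_isomorphic_if_common_structure_vector[OF nonassoc_algebra_of_vector[OF b] alg] l
    by blast
  then show ?thesis
    unfolding orbit_eq_structure_vectors[OF b] by (rule structure_vectors_isomorphic)
qed

text \<open>All structure vectors of the first algebra have the same orbit, so the choice of one of
  them drops out; at least one exists because a basis does.\<close>

lemma properly_degenerates_iff:
  assumes v: "ordered_basis scale n v" and alg1: "nonassoc_algebra scale1 n br1"
  shows "properly_degenerates scale n v scale1 br1 scale2 br2 \<longleftrightarrow>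
    (\<exists>l \<in> structure_vectors scale2 n br2.
      l \<in> zariski_topology n closure_of structure_vectors scale1 n br1 - structure_vectors scale1 n br1)"
proof -
  obtain b where "ordered_basis scale1 n b"
    using alg1 by (auto simp: nonassoc_algebra_def)
  then have "structure_vectors scale1 n br1 \<noteq> {}"
    unfolding structure_vectors_def by blast
  then show ?thesis
    unfolding properly_degenerates_def using orbit_structure_vector[OF v alg1] by auto
qed

section \<open>Structure vectors of r_n and h_n\<close>

text \<open>The structure vector of [x, y] = f(y) x - f(x) y, where \<open>f j\<close> is the value
  of the linear form on the basis vector with index \<open>j\<close>.\<close>

definition r_vector :: "nat \<Rightarrow> (nat \<Rightarrow> 'f::field) \<Rightarrow> index \<Rightarrow> 'f"
  where "r_vector n f = (\<lambda>(i, j, k)\<in>indices n. (if k = i then f j else 0) - (if k = j then f i else 0))"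

text \<open>The structure vector of [x, y] = (p(x) q(y) - p(y) q(x)) r, where \<open>P\<close> and
  \<open>Q\<close> list the values of p and q on the basis and \<open>R\<close> the coordinates of
  r.\<close>

definition h_vector ::
    "nat \<Rightarrow> (nat \<Rightarrow> 'f::field) \<Rightarrow> (nat \<Rightarrow> 'f) \<Rightarrow> (nat \<Rightarrow> 'f) \<Rightarrow> index \<Rightarrow> 'f"
  where "h_vector n P Q R = (\<lambda>(i, j, k)\<in>indices n. (P i * Q j - P j * Q i) * R k)"

text \<open>The two sums are p(r) and q(r).\<close>

definition h_vectors :: "nat \<Rightarrow> (index \<Rightarrow> 'f::field) set"
  where "h_vectors n = {h_vector n P Q R |P Q R. (\<Sum>k<n. P k * R k) = 0 \<and> (\<Sum>k<n. Q k * R k) = 0}"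

definition zero_vector :: "nat \<Rightarrow> index \<Rightarrow> 'f::field"
  where "zero_vector n = (\<lambda>i\<in>indices n. 0)"

abbreviation unit :: "nat \<Rightarrow> nat \<Rightarrow> 'f::field"
  where "unit m i \<equiv> if i = m then 1 else 0"

lemma affine_space_eqI:
  assumes "x \<in> affine_space n" "y \<in> affine_space n"
    and "\<And>i j k. i < n \<Longrightarrow> j < n \<Longrightarrow> k < n \<Longrightarrow> x (i, j, k) = y (i, j, k)"
  shows "x = y"
  by (rule PiE_ext[OF assms(1,2)[unfolded affine_space_def]]) (use assms(3) in \<open>auto simp: indices_def\<close>)

lemma vectors_in_affine_space [simp]:
  "r_vector n f \<in> affine_space n" "h_vector n P Q R \<in> affine_space n" "zero_vector n \<in> affine_space n"
  "structure_vector scale n b br \<in> affine_space n"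
  by (simp_all add: r_vector_def h_vector_def zero_vector_def structure_vector_def affine_space_def)

lemma r_vector_entry:
  "i < n \<Longrightarrow> j < n \<Longrightarrow> k < n \<Longrightarrow>
    r_vector n f (i, j, k) = (if k = i then f j else 0) - (if k = j then f i else 0)"
  by (simp add: r_vector_def indices_def)

lemma h_vector_entry:
  "i < n \<Longrightarrow> j < n \<Longrightarrow> k < n \<Longrightarrow> h_vector n P Q R (i, j, k) = (P i * Q j - P j * Q i) * R k"
  by (simp add: h_vector_def indices_def)

lemma zero_vector_entry:
  "i < n \<Longrightarrow> j < n \<Longrightarrow> k < n \<Longrightarrow> zero_vector n (i, j, k) = 0"
  by (simp add: zero_vector_def indices_def)

lemma nonzero_entry:
  assumes "l \<in> affine_space n" "l \<noteq> zero_vector n"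
  obtains i j k where "i < n" "j < n" "k < n" "l (i, j, k) \<noteq> 0"
proof -
  have "\<exists>i j k. i < n \<and> j < n \<and> k < n \<and> l (i, j, k) \<noteq> 0"
  proof (rule ccontr)
    assume "\<not> ?thesis"
    then have "l = zero_vector n"
      by (intro affine_space_eqI[OF assms(1) vectors_in_affine_space(3)]) (auto simp: zero_vector_entry)
    then show False
      using assms(2) by contradiction
  qed
  then show thesis
    using that by blast
qed

text \<open>The coefficient \<open>f j\<close> is the entry at \<open>(i, j, i)\<close> for any \<open>i \<noteq> j\<close>.\<close>

lemma closedin_r_vectors:
  assumes "n \<ge> 2"
  shows "closedin (zariski_topology n) (range (r_vector n :: (nat \<Rightarrow> 'f::field) \<Rightarrow> _))"
proof -
  \<comment> \<open>Any index other than \<open>j\<close> would serve; 0 and 1 are both available as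
    \<open>n\<close> is at least 2.\<close>
  define s where "s j = (if j = 0 then 1 else 0 :: nat)" for j :: nat
  have s: "s j < n" "s j \<noteq> j" for j
    using assms by (auto simp: s_def)
  define F where "F = {(\<lambda>x :: index \<Rightarrow> 'f. x (i, j, k)
    - ((if k = i then x (s j, j, s j) else 0) - (if k = j then x (s i, i, s i) else 0))) |i j k.
      i < n \<and> j < n \<and> k < n}"
  have "range (r_vector n) = {x \<in> affine_space n. \<forall>f\<in>F. f x = 0}"
  proof (intro equalityI subsetI)
    fix x assume "x \<in> {x \<in> affine_space n. \<forall>f\<in>F. f x = 0}"
    then have x: "x \<in> affine_space n" and F: "\<And>f. f \<in> F \<Longrightarrow> f x = 0"
      by auto
    have "x = r_vector n (\<lambda>j. x (s j, j, s j))"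
    proof (rule affine_space_eqI[OF x])
      fix i j k assume "i < n" "j < n" "k < n"
      then have "(\<lambda>x. x (i, j, k)
          - ((if k = i then x (s j, j, s j) else 0) - (if k = j then x (s i, i, s i) else 0))) \<in> F"
        unfolding F_def by blast
      from F[OF this] show "x (i, j, k) = r_vector n (\<lambda>j. x (s j, j, s j)) (i, j, k)"
        using \<open>i < n\<close> \<open>j < n\<close> \<open>k < n\<close> by (simp add: r_vector_entry)
    qed simp
    then show "x \<in> range (r_vector n)" by blast
  qed (use s in \<open>auto simp: F_def r_vector_entry\<close>)
  moreover have "polynomial_function n f" if "f \<in> F" for f
    using that unfolding F_def
    by (elim CollectE exE conjE; hypsubst) (intro polynomial_intros; simp add: indices_def s)+
  ultimately show ?thesis
    using closedin_zero_locus[of F n] by simp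
qed

text \<open>The equations are obtained by eliminating \<open>P\<close>, \<open>Q\<close> and \<open>R\<close>: where \<open>x (a, b, c) \<noteq> 0\<close>, these
  can be taken to be \<open>x (a, _, c)\<close> and \<open>x (b, _, c)\<close>, divided by \<open>x (a, b, c)\<close>, and \<open>x (a, b, _)\<close>.\<close>

lemma closedin_h_vectors: "closedin (zariski_topology n) (h_vectors n :: (index \<Rightarrow> 'f::field) set)"
proof -
  \<comment> \<open>The denominators \<open>x (a, b, c)\<close> are cleared. The equations range
    over all \<open>a\<close>, \<open>b\<close>, \<open>c\<close> because the position of a nonzero
    entry varies with the point.\<close>
  define F where "F =
      {(\<lambda>x :: index \<Rightarrow> 'f. x (a, b, c) * x (a, b, c) * x (i, j, k)
        - (x (a, i, c) * x (b, j, c) - x (a, j, c) * x (b, i, c)) * x (a, b, k)) |a b c i j k.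
        a < n \<and> b < n \<and> c < n \<and> i < n \<and> j < n \<and> k < n}
    \<union> {(\<lambda>x. \<Sum>k<n. x (a, k, c) * x (a, b, k)) |a b c. a < n \<and> b < n \<and> c < n}
    \<union> {(\<lambda>x. \<Sum>k<n. x (b, k, c) * x (a, b, k)) |a b c. a < n \<and> b < n \<and> c < n}"
  have "h_vectors n = {x \<in> affine_space n. \<forall>f\<in>F. f x = 0}"
  proof (intro equalityI subsetI)
    fix x :: "index \<Rightarrow> 'f" assume "x \<in> h_vectors n"
    then obtain P Q R where x: "x = h_vector n P Q R"
      and PR: "(\<Sum>k<n. P k * R k) = 0" and QR: "(\<Sum>k<n. Q k * R k) = 0"
      unfolding h_vectors_def by blast
    have sum: "(\<Sum>k<n. x (d, k, c) * x (a, b, k)) = 0" if "a < n" "b < n" "c < n" "d < n" for a b c d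
    proof -
      \<comment> \<open>As \<open>k\<close> varies, \<open>x (d, k, c)\<close> is a linear
        combination of \<open>P k\<close> and \<open>Q k\<close>, both of which pair to zero with
        \<open>R\<close>.\<close>
      have "(\<Sum>k<n. x (d, k, c) * x (a, b, k))
        = (\<Sum>k<n. R c * (P a * Q b - P b * Q a) * (P d * (Q k * R k) - Q d * (P k * R k)))"
        using that by (intro sum.cong refl) (simp add: x h_vector_entry algebra_simps)
      also have "\<dots> = 0"
        by (simp only: sum_distrib_left[symmetric] sum_subtractf PR QR) simp
      finally show ?thesis .
    qed
    \<comment> \<open>This is the Pluecker relation between the minors
      \<open>P i * Q j - P j * Q i\<close>, multiplied by entries of \<open>R\<close>.\<close>
    have "x (a, b, c) * x (a, b, c) * x (i, j, k)
        - (x (a, i, c) * x (b, j, c) - x (a, j, c) * x (b, i, c)) * x (a, b, k) = 0"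
      if "a < n" "b < n" "c < n" "i < n" "j < n" "k < n" for a b c i j k
      using that by (simp add: x h_vector_entry algebra_simps)
    then show "x \<in> {x \<in> affine_space n. \<forall>f\<in>F. f x = 0}"
      using sum by (auto simp: F_def x)
  next
    fix x :: "index \<Rightarrow> 'f" assume "x \<in> {x \<in> affine_space n. \<forall>f\<in>F. f x = 0}"
    then have x: "x \<in> affine_space n" and F: "\<And>f. f \<in> F \<Longrightarrow> f x = 0"
      by auto
    show "x \<in> h_vectors n"
    proof (cases "x = zero_vector n")
      case True
      then have "x = h_vector n (\<lambda>_. 0) (\<lambda>_. 0) (\<lambda>_. 0)"
        by (auto simp: zero_vector_def h_vector_def)
      then show ?thesis
        unfolding h_vectors_def by (auto intro!: exI[of _ "\<lambda>_. 0"])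
    next
      case False
      then obtain a b c where abc: "a < n" "b < n" "c < n" "x (a, b, c) \<noteq> 0"
        using nonzero_entry[OF x] by blast
      define P Q R where "P i = x (a, i, c) / x (a, b, c)" and "Q i = x (b, i, c) / x (a, b, c)"
        and "R i = x (a, b, i)" for i
      have "x (i, j, k) = (P i * Q j - P j * Q i) * R k" if "i < n" "j < n" "k < n" for i j k
      proof -
        have "(\<lambda>x. x (a, b, c) * x (a, b, c) * x (i, j, k)
            - (x (a, i, c) * x (b, j, c) - x (a, j, c) * x (b, i, c)) * x (a, b, k)) \<in> F"
          unfolding F_def using that abc by blast
        from F[OF this] show ?thesis
          using abc(4) by (simp add: P_def Q_def R_def field_simps)
      qed
      then have "x = h_vector n P Q R"
        by (intro affine_space_eqI[OF x]) (simp_all add: h_vector_entry)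
      moreover have "(\<lambda>x. \<Sum>k<n. x (a, k, c) * x (a, b, k)) \<in> F"
          "(\<lambda>x. \<Sum>k<n. x (b, k, c) * x (a, b, k)) \<in> F"
        unfolding F_def using abc by blast+
      from this[THEN F] have "(\<Sum>k<n. P k * R k) = 0" "(\<Sum>k<n. Q k * R k) = 0"
        by (simp_all add: P_def Q_def R_def sum_divide_distrib[symmetric])
      ultimately show ?thesis
        unfolding h_vectors_def by blast
    qed
  qed
  moreover have "polynomial_function n f" if "f \<in> F" for f
    using that unfolding F_def
    by (elim UnE CollectE exE conjE; hypsubst) (intro polynomial_intros; simp add: indices_def)+
  ultimately show ?thesis
    using closedin_zero_locus[of F n] by simp
qed

section \<open>Coordinate-free product formulas\<close>

context based_space
begin

lemma ordered_basis_of_set3: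
  assumes "independent B" "span B = UNIV" "n \<ge> 3"
    and "x \<in> B" "y \<in> B" "z \<in> B" "x \<noteq> y" "x \<noteq> z" "y \<noteq> z"
  obtains c where "ordered_basis scale n c" "c ` {..<n} = B" "c 0 = x" "c 1 = y" "c 2 = z"
proof -
  define g where "g i = (if i = 0 then x else if i = 1 then y else z)" for i :: nat
  have "{0, 1, 2} \<subseteq> {..<n}" "inj_on g {0, 1, 2}" "g ` {0, 1, 2} \<subseteq> B"
    using assms by (auto simp: g_def)
  then obtain c where "ordered_basis scale n c" "c ` {..<n} = B" "\<And>i. i \<in> {0, 1, 2} \<Longrightarrow> c i = g i"
    by (rule ordered_basis_of_set[OF assms(1,2)]) blast
  then show thesis
    by (intro that[of c]) (simp_all add: g_def)
qed

text \<open>Turns a list of values on one basis into a function on the space, which can then be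
  evaluated on any other basis.\<close>

definition linear_form :: "(nat \<Rightarrow> 'f) \<Rightarrow> 'v \<Rightarrow> 'f"
  where "linear_form f x = (\<Sum>i<n. coord x i * f i)"

lemma linear_form_basis: "i < n \<Longrightarrow> linear_form f (b i) = f i"
proof -
  assume "i < n"
  then have "linear_form f (b i) = (\<Sum>j<n. if j = i then f i else 0)"
    unfolding linear_form_def by (intro sum.cong refl) (simp add: coordinate_basis)
  then show ?thesis
    using \<open>i < n\<close> by simp
qed

lemma linear_form_add: "linear_form f (x + y) = linear_form f x + linear_form f y"
  by (simp add: linear_form_def coordinate_add distrib_right sum.distrib)

lemma linear_form_diff: "linear_form f (x - y) = linear_form f x - linear_form f y"
  by (simp add: linear_form_def coordinate_diff left_diff_distrib sum_subtractf)

lemma linear_form_scale: "linear_form f (scale a x) = a * linear_form f x"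
  by (simp add: linear_form_def coordinate_scale sum_distrib_left mult.assoc)

lemma linear_form_zero: "linear_form f 0 = 0"
  by (simp add: linear_form_def coordinate_zero)

lemma linear_form_sum: "linear_form f (\<Sum>k\<in>A. x k) = (\<Sum>k\<in>A. linear_form f (x k))"
  by (induction A rule: infinite_finite_induct) (simp_all add: linear_form_zero linear_form_add)

lemma linear_form_combination:
  "linear_form f (\<Sum>k<n. scale (a k) (b k)) = (\<Sum>k<n. f k * a k)"
  by (simp add: linear_form_sum linear_form_scale linear_form_basis mult.commute)

lemma sum_r_vector:
  assumes "i < n" "j < n"
  shows "(\<Sum>k<n. scale (r_vector n f (i, j, k)) (b k)) = scale (f j) (b i) - scale (f i) (b j)"
proof -
  have "(\<Sum>k<n. scale (r_vector n f (i, j, k)) (b k))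
    = (\<Sum>k<n. (if k = i then scale (f j) (b i) else 0) - (if k = j then scale (f i) (b j) else 0))"
    using assms by (intro sum.cong refl) (auto simp: r_vector_entry scale_left_diff_distrib)
  then show ?thesis
    using assms by (simp add: sum_subtractf)
qed

lemma sum_h_vector:
  assumes "i < n" "j < n"
  shows "(\<Sum>k<n. scale (h_vector n P Q R (i, j, k)) (b k))
    = scale (P i * Q j - P j * Q i) (\<Sum>k<n. scale (R k) (b k))"
  using assms by (simp add: h_vector_entry scale_sum_right)

lemma sum_unit: "m < n \<Longrightarrow> (\<Sum>k<n. scale (unit m k) (b k)) = b m"
proof -
  assume "m < n"
  have "(\<Sum>k<n. scale (unit m k) (b k)) = (\<Sum>k<n. if k = m then b m else 0)"
    by (intro sum.cong refl) simp
  then show ?thesis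
    using \<open>m < n\<close> by simp
qed

lemma structure_vector_r_algebra: "structure_vector scale n b (r_algebra scale n b) = r_vector n (unit (n - 1))"
  unfolding r_algebra_def
  by (rule structure_vector_bilinear_extension) (auto simp: sum_r_vector)

lemma structure_vector_h_algebra:
  assumes "n \<ge> 3"
  shows "structure_vector scale n b (h_algebra scale n b) = h_vector n (unit 0) (unit 1) (unit 2)"
  unfolding h_algebra_def
  by (rule structure_vector_bilinear_extension) (use assms in \<open>auto simp: sum_h_vector sum_unit\<close>)

lemma structure_vector_a_algebra: "structure_vector scale n b a_algebra = zero_vector n"
  by (rule structure_vector_eqI) (auto simp: a_algebra_def zero_vector_entry intro!: sum.neutral[symmetric])

lemma bracket_r_vector:
  assumes "nonassoc_algebra scale n br" "structure_vector scale n b br = r_vector n f"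
  shows "br x y = scale (linear_form f y) x - scale (linear_form f x) y"
proof -
  have "br x y = (\<Sum>i<n. \<Sum>j<n. scale (coord x i * coord y j) (scale (f j) (b i) - scale (f i) (b j)))"
    unfolding bracket_expand[OF assms(1), of x y]
    by (intro sum.cong refl) (simp add: structure_vector_combination[symmetric] assms(2) sum_r_vector)
  also have "\<dots> = (\<Sum>i<n. \<Sum>j<n. scale (coord y j * f j) (scale (coord x i) (b i)))
      - (\<Sum>i<n. \<Sum>j<n. scale (coord x i * f i) (scale (coord y j) (b j)))"
    by (simp add: scale_right_diff_distrib sum_subtractf mult_ac)
  also have "\<dots> = scale (linear_form f y) (\<Sum>i<n. scale (coord x i) (b i))
      - scale (linear_form f x) (\<Sum>j<n. scale (coord y j) (b j))"
    by (simp only: linear_form_def scale_sum_left[symmetric] scale_sum_right[symmetric])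
  finally show ?thesis
    by (simp add: sum_coordinate)
qed

lemma bracket_h_vector:
  assumes "nonassoc_algebra scale n br" "structure_vector scale n b br = h_vector n P Q R"
  shows "br x y = scale (linear_form P x * linear_form Q y - linear_form P y * linear_form Q x)
    (\<Sum>k<n. scale (R k) (b k))" (is "_ = scale _ ?r")
proof -
  have "br x y = (\<Sum>i<n. \<Sum>j<n. scale (coord x i * coord y j) (scale (P i * Q j - P j * Q i) ?r))"
    unfolding bracket_expand[OF assms(1), of x y]
    by (intro sum.cong refl) (simp add: structure_vector_combination[symmetric] assms(2) sum_h_vector)
  also have "\<dots> = scale (\<Sum>i<n. \<Sum>j<n. coord x i * P i * (coord y j * Q j) - coord x i * Q i * (coord y j * P j)) ?r"
    by (simp add: scale_sum_left right_diff_distrib mult_ac)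
  also have "(\<Sum>i<n. \<Sum>j<n. coord x i * P i * (coord y j * Q j) - coord x i * Q i * (coord y j * P j))
      = linear_form P x * linear_form Q y - linear_form P y * linear_form Q x"
    unfolding mult.commute[of "linear_form P y"]
    by (simp only: linear_form_def sum_product sum_subtractf)
  finally show ?thesis .
qed

end

section \<open>Change of basis and normal forms in the two families\<close>

lemma structure_vectorsE:
  assumes "l \<in> structure_vectors scale n br"
  obtains b where "based_space scale n b" "l = structure_vector scale n b br"
  using assms unfolding structure_vectors_def based_space_iff by blast

text \<open>In the formula f(y) x - f(x) y the basis no longer occurs; relative to a basis
  \<open>c\<close> it gives the \<open>r_vector\<close> of the values of f on
  \<open>c\<close>.\<close>

lemma structure_vectors_subset_r_vectors:
  assumes "nonassoc_algebra scale n br" "r_vector n f \<in> structure_vectors scale n br"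
  shows "structure_vectors scale n br \<subseteq> range (r_vector n)"
proof
  obtain b where "based_space scale n b" and b: "structure_vector scale n b br = r_vector n f"
    using structure_vectorsE[OF assms(2)] by metis
  interpret B: based_space scale n b by fact
  fix l assume "l \<in> structure_vectors scale n br"
  then obtain c where "based_space scale n c" and l: "l = structure_vector scale n c br"
    by (rule structure_vectorsE)
  interpret C: based_space scale n c by fact
  have "structure_vector scale n c br = r_vector n (\<lambda>i. B.linear_form f (c i))"
    by (rule C.structure_vector_eqI) (simp_all add: C.sum_r_vector B.bracket_r_vector[OF assms(1) b])
  then show "l \<in> range (r_vector n)"
    unfolding l by blast
qed

lemma structure_vectors_subset_h_vectors:
  assumes "nonassoc_algebra scale n br" "l \<in> h_vectors n" "l \<in> structure_vectors scale n br"
  shows "structure_vectors scale n br \<subseteq> h_vectors n"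
proof
  obtain P Q R where l: "l = h_vector n P Q R" "(\<Sum>k<n. P k * R k) = 0" "(\<Sum>k<n. Q k * R k) = 0"
    using assms(2) unfolding h_vectors_def by blast
  obtain b where "based_space scale n b" and b: "structure_vector scale n b br = h_vector n P Q R"
    using structure_vectorsE[OF assms(3)] l by metis
  interpret B: based_space scale n b by fact
  define r where "r = (\<Sum>k<n. scale (R k) (b k))"
  have r: "B.linear_form P r = 0" "B.linear_form Q r = 0"
    unfolding r_def B.linear_form_combination by (rule l)+
  fix m assume "m \<in> structure_vectors scale n br"
  then obtain c where "based_space scale n c" and m: "m = structure_vector scale n c br"
    by (rule structure_vectorsE)
  interpret C: based_space scale n c by fact
  have "structure_vector scale n c br
      = h_vector n (\<lambda>i. B.linear_form P (c i)) (\<lambda>i. B.linear_form Q (c i)) (C.coord r)"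
    by (rule C.structure_vector_eqI)
      (simp_all add: C.sum_h_vector C.sum_coordinate B.bracket_h_vector[OF assms(1) b] r_def)
  \<comment> \<open>The pairing of values and coordinates is the value at \<open>r\<close> in every
    basis, so the two vanishing conditions carry over to \<open>c\<close>.\<close>
  moreover have "(\<Sum>k<n. B.linear_form f (c k) * C.coord r k) = B.linear_form f r" for f
  proof -
    have "B.linear_form f r = B.linear_form f (\<Sum>k<n. scale (C.coord r k) (c k))"
      by (simp add: C.sum_coordinate)
    then show ?thesis
      by (simp add: B.linear_form_sum B.linear_form_scale mult.commute)
  qed
  from this[of P] this[of Q] have "(\<Sum>k<n. B.linear_form P (c k) * C.coord r k) = 0"
    "(\<Sum>k<n. B.linear_form Q (c k) * C.coord r k) = 0"
    by (simp_all only: r)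
  ultimately show "m \<in> h_vectors n"
    unfolding m h_vectors_def by blast
qed

text \<open>A nonzero form f takes the value 1 at some vector \<open>e\<close>. A basis of the
  kernel of f, with \<open>e\<close> put last, gives [c_i, e] = c_i and zero products inside the
  kernel, as in r_n.\<close>

lemma standard_r_vector_in_structure_vectors:
  assumes alg: "nonassoc_algebra scale n br"
    and f: "r_vector n f \<in> structure_vectors scale n br" "r_vector n f \<noteq> zero_vector n"
  shows "r_vector n (unit (n - 1)) \<in> structure_vectors scale n br"
proof -
  obtain b where "based_space scale n b" and b: "structure_vector scale n b br = r_vector n f"
    using structure_vectorsE[OF f(1)] by metis
  interpret B: based_space scale n b by fact
  let ?\<phi> = "B.linear_form f"
  obtain i j k where ijk: "i < n" "j < n" "k < n" "r_vector n f (i, j, k) \<noteq> 0"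
    by (rule nonzero_entry[OF _ f(2)]) simp
  then have "f i \<noteq> 0 \<or> f j \<noteq> 0"
    by (auto simp: r_vector_entry split: if_splits)
  then obtain m where m: "m < n" "f m \<noteq> 0"
    using ijk by blast
  define e where "e = scale (1 / f m) (b m)"
  have e: "?\<phi> e = 1"
    using m by (simp add: e_def B.linear_form_scale B.linear_form_basis)
  define K where "K = {x. ?\<phi> x = 0}"
  have K: "B.subspace K"
    by (simp add: K_def B.subspace_def B.linear_form_zero B.linear_form_add B.linear_form_scale)
  obtain S where S: "S \<subseteq> K" "B.independent S" "K \<subseteq> B.span S"
    using B.maximal_independent_subset .
  have "B.span S \<subseteq> K"
    using S(1) K by (rule B.span_minimal)
  then have indep: "B.independent (insert e S)"
    using e S(2) by (intro B.independent_insertI) (auto simp: K_def)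
  have "x \<in> B.span (insert e S)" for x
  proof -
    have "x - scale (?\<phi> x) e \<in> K"
      by (simp add: K_def B.linear_form_diff B.linear_form_scale e)
    then show ?thesis
      unfolding B.span_breakdown_eq using S(3) by blast
  qed
  then have span: "B.span (insert e S) = UNIV"
    by blast
  obtain c where c: "ordered_basis scale n c" "c ` {..<n} = insert e S" "c (n - 1) = e"
    by (rule B.ordered_basis_of_set[OF indep span, of "{n - 1}" "\<lambda>_. e"]) (use m in auto)
  interpret C: based_space scale n c using c by (simp add: based_space_iff)
  have \<phi>: "?\<phi> (c i) = unit (n - 1) i" if "i < n" for i
  proof (cases "i = n - 1")
    case False
    then have "c i \<noteq> e"
      using c(3) C.inj that inj_onD[of c "{..<n}" i "n - 1"] by auto
    then have "c i \<in> K"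
      using c(2) S(1) that by auto
    then show ?thesis
      using False by (simp add: K_def)
  qed (use c(3) e in simp)
  have "structure_vector scale n c br = r_vector n (unit (n - 1))"
    by (rule C.structure_vector_eqI) (simp_all add: C.sum_r_vector B.bracket_r_vector[OF alg b] \<phi>)
  then show ?thesis
    using C.structure_vector_in_structure_vectors by metis
qed

text \<open>The common kernel \<open>K\<close> of p and q is central and contains \<open>r\<close>.
  A basis of \<open>K\<close> through [x, y] = \<open>scale \<Delta> r\<close> is completed by
  \<open>x\<close> and \<open>y\<close>; these are independent modulo \<open>K\<close> because the
  determinant \<Delta> of p and q on them is nonzero.\<close>

lemma standard_h_vector_in_structure_vectors:
  assumes n: "n \<ge> 3" and alg: "nonassoc_algebra scale n br"
    and l: "l \<in> h_vectors n" "l \<in> structure_vectors scale n br" "l \<noteq> zero_vector n"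
  shows "h_vector n (unit 0) (unit 1) (unit 2) \<in> structure_vectors scale n br"
proof -
  obtain P Q R where PQR: "l = h_vector n P Q R" "(\<Sum>k<n. P k * R k) = 0" "(\<Sum>k<n. Q k * R k) = 0"
    using l(1) unfolding h_vectors_def by blast
  obtain b where "based_space scale n b" and b: "structure_vector scale n b br = h_vector n P Q R"
    using structure_vectorsE[OF l(2)] PQR by metis
  interpret B: based_space scale n b by fact
  let ?p = "B.linear_form P" and ?q = "B.linear_form Q"
  define r where "r = (\<Sum>k<n. scale (R k) (b k))"
  have r: "?p r = 0" "?q r = 0"
    unfolding r_def B.linear_form_combination by (rule PQR)+
  have br: "br x y = scale (?p x * ?q y - ?p y * ?q x) r" for x y
    unfolding r_def by (rule B.bracket_h_vector[OF alg b])
  obtain i j k where ijk: "i < n" "j < n" "k < n" "l (i, j, k) \<noteq> 0"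
    by (rule nonzero_entry[OF _ l(3)]) (simp_all add: PQR)
  define x y where "x = b i" and "y = b j"
  define \<Delta> where "\<Delta> = ?p x * ?q y - ?p y * ?q x"
  have "\<Delta> \<noteq> 0" "R k \<noteq> 0"
    using ijk by (auto simp: PQR h_vector_entry \<Delta>_def x_def y_def B.linear_form_basis)
  moreover have "r \<noteq> 0"
  proof
    assume "r = 0"
    then have "B.coord r k = 0"
      by (simp add: B.coordinate_zero)
    then show False
      using \<open>R k \<noteq> 0\<close> ijk by (simp add: r_def B.coordinate_combination)
  qed
  ultimately have z: "scale \<Delta> r \<noteq> 0"
    by simp
  define K where "K = {u. ?p u = 0 \<and> ?q u = 0}"
  have K: "B.subspace K"
    by (simp add: K_def B.subspace_def B.linear_form_zero B.linear_form_add B.linear_form_scale)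
  have "{scale \<Delta> r} \<subseteq> K" "B.independent {scale \<Delta> r}"
    using r z by (simp_all add: K_def B.linear_form_scale)
  then obtain S where S: "{scale \<Delta> r} \<subseteq> S" "S \<subseteq> K" "B.independent S" "K \<subseteq> B.span S"
    by (rule B.maximal_independent_subset_extend)
  have spanS: "B.span S \<subseteq> K"
    using S(2) K by (rule B.span_minimal)
  have "x \<notin> B.span S"
    using spanS \<open>\<Delta> \<noteq> 0\<close> by (auto simp: K_def \<Delta>_def)
  moreover have "y \<notin> B.span (insert x S)"
  proof
    assume "y \<in> B.span (insert x S)"
    then obtain a where "y - scale a x \<in> K"
      unfolding B.span_breakdown_eq using spanS by blast
    then have "?p y = a * ?p x" "?q y = a * ?q x"
      by (simp_all add: K_def B.linear_form_diff B.linear_form_scale)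
    then show False
      using \<open>\<Delta> \<noteq> 0\<close> by (simp add: \<Delta>_def)
  qed
  ultimately have indep: "B.independent (insert y (insert x S))"
    using S(3) by (intro B.independent_insertI)
  have "u \<in> B.span (insert y (insert x S))" for u
  proof -
    \<comment> \<open>Cramer's rule for the combination of \<open>x\<close> and \<open>y\<close> on
      which p and q agree with their values at \<open>u\<close>.\<close>
    define \<alpha> \<beta> where "\<alpha> = (?p u * ?q y - ?p y * ?q u) / \<Delta>" and "\<beta> = (?p x * ?q u - ?p u * ?q x) / \<Delta>"
    have "\<alpha> * ?p x + \<beta> * ?p y = ?p u * \<Delta> / \<Delta>" "\<alpha> * ?q x + \<beta> * ?q y = ?q u * \<Delta> / \<Delta>"
      unfolding \<alpha>_def \<beta>_def times_divide_eq_left add_divide_distrib[symmetric]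
      by (simp_all add: \<Delta>_def algebra_simps)
    then have "?p u = \<alpha> * ?p x + \<beta> * ?p y" "?q u = \<alpha> * ?q x + \<beta> * ?q y"
      using \<open>\<Delta> \<noteq> 0\<close> by simp_all
    then have "u - scale \<beta> y - scale \<alpha> x \<in> K"
      by (simp add: K_def B.linear_form_diff B.linear_form_scale)
    then show ?thesis
      unfolding B.span_breakdown_eq using S(4) by blast
  qed
  then have span: "B.span (insert y (insert x S)) = UNIV"
    by blast
  have "x \<noteq> y" "x \<notin> S" "y \<notin> S"
    using \<open>x \<notin> B.span S\<close> \<open>y \<notin> B.span (insert x S)\<close> by (auto intro: B.span_base)
  moreover have "scale \<Delta> r \<in> S"
    using S(1) by simp
  ultimately obtain c where c: "ordered_basis scale n c" "c ` {..<n} = insert y (insert x S)"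
    and c012: "c 0 = x" "c 1 = y" "c 2 = scale \<Delta> r"
    using B.ordered_basis_of_set3[OF indep span n, of x y "scale \<Delta> r"] by blast
  interpret C: based_space scale n c using c by (simp add: based_space_iff)
  have K_rest: "?p (c i) = 0 \<and> ?q (c i) = 0" if "i < n" "i \<noteq> 0" "i \<noteq> 1" for i
  proof -
    have "c i \<noteq> c 0" "c i \<noteq> c 1"
      using inj_onD[OF C.inj, of i] that n by auto
    then have "c i \<in> K"
      using c(2) S(2) that unfolding c012 by auto
    then show ?thesis
      by (simp add: K_def)
  qed
  have pq: "?p (c i) = (if i = 0 then ?p x else if i = 1 then ?p y else 0)"
    "?q (c i) = (if i = 0 then ?q x else if i = 1 then ?q y else 0)" if "i < n" for i
    using K_rest[OF that] c012 by auto
  have "structure_vector scale n c br = h_vector n (unit 0) (unit 1) (unit 2)"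
  proof (rule C.structure_vector_eqI)
    fix i j assume "i < n" "j < n"
    then have "?p (c i) * ?q (c j) - ?p (c j) * ?q (c i) = (unit 0 i * unit 1 j - unit 0 j * unit 1 i) * \<Delta>"
      unfolding pq[OF \<open>i < n\<close>] pq[OF \<open>j < n\<close>] by (simp add: \<Delta>_def)
    then show "br (c i) (c j) = (\<Sum>k<n. scale (h_vector n (unit 0) (unit 1) (unit 2) (i, j, k)) (c k))"
      using \<open>i < n\<close> \<open>j < n\<close> n by (simp only: C.sum_h_vector C.sum_unit c012 br) simp
  qed simp
  then show ?thesis
    using C.structure_vector_in_structure_vectors by metis
qed

section \<open>Degenerations\<close>

text \<open>Replacing \<open>b i\<close> by t^(w i) \<open>b i\<close> multiplies the entry at (i,
  j, k) by t^(w i + w j - w k). The hypothesis on \<open>w\<close> keeps the exponents nonnegative,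
  and at t = 0 only the entries with exponent 0 remain.\<close>

lemma weighted_degeneration:
  fixes w :: "nat \<Rightarrow> nat"
  assumes inf: "infinite (UNIV :: 'f::field set)"
    and b: "ordered_basis (scale :: 'f \<Rightarrow> 'v::ab_group_add \<Rightarrow> 'v) n b"
    and alg: "nonassoc_algebra scale n br"
    and w: "\<And>i j k. i < n \<Longrightarrow> j < n \<Longrightarrow> k < n \<Longrightarrow> w k \<le> w i + w j"
  shows "(\<lambda>(i, j, k)\<in>indices n. if w i + w j = w k then structure_vector scale n b br (i, j, k) else 0)
    \<in> zariski_topology n closure_of structure_vectors scale n br"
proof -
  interpret B: based_space scale n b using b by (simp add: based_space_iff)
  let ?l = "structure_vector scale n b br"
  \<comment> \<open>On \<open>indices n\<close> the subtraction of naturals is never truncated, by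
    the hypothesis on \<open>w\<close>.\<close>
  define q where "q = (\<lambda>(i, j, k). monom (?l (i, j, k)) (w i + w j - w k))"
  have "(\<lambda>i\<in>indices n. poly (q i) t) \<in> structure_vectors scale n br" if "t \<noteq> 0" for t
  proof -
    define c where "c i = scale (t ^ w i) (b i)" for i
    have "b i \<in> B.span (c ` {..<n})" if "i < n" for i
    proof -
      have "b i = scale (inverse (t ^ w i)) (c i)"
        using \<open>t \<noteq> 0\<close> by (simp add: c_def)
      then show ?thesis
        using that by (metis B.span_base B.span_scale imageI lessThan_iff)
    qed
    then have "ordered_basis scale n c"
      by (rule B.ordered_basis_if_generates)
    then interpret C: based_space scale n c by (simp add: based_space_iff)
    have lin: "br (scale u x) (scale u' y) = scale (u * u') (br x y)" for u u' x y
      using alg by (simp add: nonassoc_algebra_def Vector_Spaces.linear_iff)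
    have "structure_vector scale n c br = (\<lambda>i\<in>indices n. poly (q i) t)"
    proof (rule C.structure_vector_eqI)
      fix i j assume ij: "i < n" "j < n"
      have "br (c i) (c j) = scale (t ^ (w i + w j)) (\<Sum>k<n. scale (?l (i, j, k)) (b k))"
        using ij by (simp add: c_def lin power_add B.structure_vector_combination)
      also have "\<dots> = (\<Sum>k<n. scale (poly (q (i, j, k)) t) (c k))"
        unfolding B.scale_sum_right
      proof (rule sum.cong[OF refl])
        fix k assume "k \<in> {..<n}"
        then have "t ^ (w i + w j) = t ^ (w i + w j - w k) * t ^ w k"
          using w ij by (simp add: power_add[symmetric])
        then show "scale (t ^ (w i + w j)) (scale (?l (i, j, k)) (b k)) = scale (poly (q (i, j, k)) t) (c k)"
          by (simp add: q_def c_def poly_monom mult_ac)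
      qed
      finally show "br (c i) (c j) = (\<Sum>k<n. scale ((\<lambda>i\<in>indices n. poly (q i) t) (i, j, k)) (c k))"
        using ij by (simp add: indices_def)
    qed (simp add: affine_space_def)
    then show ?thesis
      using C.structure_vector_in_structure_vectors by metis
  qed
  then have "(\<lambda>i\<in>indices n. poly (q i) 0) \<in> zariski_topology n closure_of structure_vectors scale n br"
    by (rule curve_limit_in_closure[OF inf])
  also have "(\<lambda>i\<in>indices n. poly (q i) 0)
      = (\<lambda>(i, j, k)\<in>indices n. if w i + w j = w k then ?l (i, j, k) else 0)"
  proof (rule restrict_ext, clarify)
    fix i j k assume "(i, j, k) \<in> indices n"
    then have "w k \<le> w i + w j"
      using w by (simp add: indices_def)
    then show "poly (q (i, j, k)) 0 = (if w i + w j = w k then ?l (i, j, k) else 0)"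
      by (auto simp: q_def poly_monom power_0_left)
  qed
  finally show ?thesis .
qed

lemma zero_vector_in_closure:
  assumes "infinite (UNIV :: 'f::field set)"
    and alg: "nonassoc_algebra (scale :: 'f \<Rightarrow> 'v::ab_group_add \<Rightarrow> 'v) n br"
  shows "zero_vector n \<in> zariski_topology n closure_of structure_vectors scale n br"
proof -
  obtain b where "ordered_basis scale n b"
    using alg by (auto simp: nonassoc_algebra_def)
  \<comment> \<open>All weights are 1, so every exponent is 1 and no entry survives.\<close>
  then have "(\<lambda>(i, j, k)\<in>indices n. if 1 + 1 = (1::nat) then structure_vector scale n b br (i, j, k) else 0)
      \<in> zariski_topology n closure_of structure_vectors scale n br"
    by (rule weighted_degeneration[OF assms(1) _ alg, of b "\<lambda>_. 1"]) simp
  then show ?thesis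
    by (simp add: zero_vector_def case_prod_unfold)
qed

lemma nonassoc_algebra_a_algebra: "ordered_basis scale n v \<Longrightarrow> nonassoc_algebra scale n a_algebra"
  by (auto simp: nonassoc_algebra_def a_algebra_def Vector_Spaces.linear_iff ordered_basis_def
      module_iff_vector_space[symmetric] module.scale_zero_right)

lemma structure_vectors_a_algebra:
  assumes "ordered_basis scale n v"
  shows "structure_vectors scale n a_algebra = {zero_vector n}"
proof -
  have "structure_vector scale n b a_algebra = zero_vector n" if "ordered_basis scale n b" for b
    using that by (simp add: based_space_iff[symmetric] based_space.structure_vector_a_algebra)
  then show ?thesis
    using assms by (auto simp: structure_vectors_def intro!: exI[of _ v])
qed

lemma isomorphic_a_algebra_iff:
  assumes "ordered_basis scale n v" "nonassoc_algebra scale' n br"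
  shows "algebra_isomorphic scale' br scale a_algebra \<longleftrightarrow> zero_vector n \<in> structure_vectors scale' n br"
  using structure_vectors_isomorphic[of scale' br scale a_algebra n]
    algebra_isomorphic_if_common_structure_vector[OF assms(2) nonassoc_algebra_a_algebra[OF assms(1)]]
    structure_vectors_a_algebra[OF assms(1)] by blast

lemma structure_vectors_abelian:
  assumes "nonassoc_algebra scale n br" "zero_vector n \<in> structure_vectors scale n br"
  shows "structure_vectors scale n br = {zero_vector n}"
proof -
  obtain v where v: "ordered_basis scale n v"
    using assms(1) by (auto simp: nonassoc_algebra_def)
  have "algebra_isomorphic scale br scale a_algebra"
    using isomorphic_a_algebra_iff[OF v assms(1)] assms(2) by blast
  from structure_vectors_isomorphic[OF this, of n] show ?thesis
    using structure_vectors_a_algebra[OF v] by blast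
qed

text \<open>The argument common to r_n and h_n. \<open>Z\<close> is a closed family containing the
  orbit, and \<open>l0\<close> a normal form: an algebra with a nonzero structure vector in
  \<open>Z\<close> has \<open>l0\<close> too, so it is isomorphic to \<open>br\<close> and the
  degeneration is not proper. Only the zero vector remains, and it does lie in the closure.\<close>

lemma properly_degenerates_iff_abelian:
  fixes scale :: "'f::field \<Rightarrow> 'v::ab_group_add \<Rightarrow> 'v" and scale' :: "'f \<Rightarrow> 'w::ab_group_add \<Rightarrow> 'w"
  assumes inf: "infinite (UNIV :: 'f set)"
    and v: "ordered_basis scale n v"
    and alg: "nonassoc_algebra scale' n br" "nonassoc_algebra scale n br'"
    and Z: "closedin (zariski_topology n) Z" "structure_vectors scale' n br \<subseteq> Z"
    and nonzero: "zero_vector n \<notin> structure_vectors scale' n br"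
    and l0: "l0 \<in> structure_vectors scale' n br"
      "\<And>l. l \<in> Z \<Longrightarrow> l \<in> structure_vectors scale n br' \<Longrightarrow> l \<noteq> zero_vector n \<Longrightarrow>
        l0 \<in> structure_vectors scale n br'"
  shows "properly_degenerates scale n v scale' br scale br' \<longleftrightarrow> algebra_isomorphic scale br' scale a_algebra"
  unfolding properly_degenerates_iff[OF v alg(1)] isomorphic_a_algebra_iff[OF v alg(2)]
proof
  assume "\<exists>l\<in>structure_vectors scale n br'.
    l \<in> zariski_topology n closure_of structure_vectors scale' n br - structure_vectors scale' n br"
  then obtain l where l: "l \<in> structure_vectors scale n br'" "l \<in> Z" "l \<notin> structure_vectors scale' n br"
    using closure_of_minimal[OF Z(2,1)] by blast
  have "l = zero_vector n"
  proof (rule ccontr)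
    assume "l \<noteq> zero_vector n"
    with l have "l0 \<in> structure_vectors scale n br'"
      using l0(2) by blast
    then have "algebra_isomorphic scale br' scale' br"
      by (rule algebra_isomorphic_if_common_structure_vector[OF alg(2,1) _ l0(1)])
    from structure_vectors_isomorphic[OF this, of n] show False
      using l by blast
  qed
  then show "zero_vector n \<in> structure_vectors scale n br'"
    using l by simp
next
  assume "zero_vector n \<in> structure_vectors scale n br'"
  then show "\<exists>l\<in>structure_vectors scale n br'.
    l \<in> zariski_topology n closure_of structure_vectors scale' n br - structure_vectors scale' n br"
    using zero_vector_in_closure[OF inf alg(1)] nonzero by blast
qed

lemma r_vector_unit_nonzero:
  assumes "n \<ge> 2"
  shows "r_vector n (unit (n - 1)) \<noteq> (zero_vector n :: index \<Rightarrow> 'f::field)"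
proof
  assume "r_vector n (unit (n - 1)) = (zero_vector n :: index \<Rightarrow> 'f)"
  then have "r_vector n (unit (n - 1)) (0, n - 1, 0) = (zero_vector n (0, n - 1, 0) :: 'f)"
    by simp
  then show False
    using assms by (simp add: r_vector_entry zero_vector_entry)
qed

lemma h_vector_unit_nonzero:
  assumes "n \<ge> 3"
  shows "h_vector n (unit 0) (unit 1) (unit 2) \<noteq> (zero_vector n :: index \<Rightarrow> 'f::field)"
proof
  assume "h_vector n (unit 0) (unit 1) (unit 2) = (zero_vector n :: index \<Rightarrow> 'f)"
  then have "h_vector n (unit 0) (unit 1) (unit 2) (0, 1, 2) = (zero_vector n (0, 1, 2) :: 'f)"
    by simp
  then show False
    using assms by (simp add: h_vector_entry zero_vector_entry)
qed

lemma h_vector_unit_in_h_vectors: "h_vector n (unit 0) (unit 1) (unit 2) \<in> h_vectors n"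
  unfolding h_vectors_def
  by (rule CollectI, intro exI conjI, rule refl) (auto intro!: sum.neutral)

section \<open>Planar and nonplanar alternating products\<close>

lemma alternating_antisymmetric:
  assumes "nonassoc_algebra scale n br" "\<And>x. br x x = 0"
  shows "br y x = - br x y"
proof -
  have "br (x + y) (x + y) = br x x + br x y + (br y x + br y y)"
    using assms(1) by (simp add: nonassoc_algebra_def Vector_Spaces.linear_iff)
  then have "br x y + br y x = 0"
    using assms(2) by simp
  then show ?thesis
    by (simp add: eq_neg_iff_add_eq_0 add.commute)
qed

text \<open>If \<open>[b i, b j] = \<alpha> b i + \<beta> b j\<close>, applying the hypothesis to \<open>b i + b k\<close> and \<open>b j\<close>
  shows that the coefficient \<open>\<alpha>\<close> depends only on \<open>j\<close>.\<close>

lemma structure_vector_of_planar_bracket: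
  assumes b: "ordered_basis scale n b" and n: "n \<ge> 2"
    and alg: "nonassoc_algebra scale n br" "\<And>x. br x x = 0"
    and planar: "\<And>x y. br x y \<in> module.span scale {x, y}"
  shows "structure_vector scale n b br \<in> range (r_vector n)"
proof -
  interpret based_space scale n b using b by (simp add: based_space_iff)
  let ?l = "structure_vector scale n b br"
  have combination: "\<exists>\<alpha> \<beta>. br x y = scale \<alpha> x + scale \<beta> y" for x y
  proof -
    obtain \<alpha> where "br x y - scale \<alpha> x \<in> span {y}"
      using planar[of x y] unfolding span_breakdown_eq[of _ x] by blast
    then obtain \<beta> where "br x y - scale \<alpha> x = scale \<beta> y"
      by (auto simp: span_singleton)
    then have "br x y = scale \<alpha> x + scale \<beta> y"
      by (simp add: algebra_simps)
    then show ?thesis by blast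
  qed
  have l: "?l (i, j, k) = coord (br (b i) (b j)) k" if "i < n" "j < n" "k < n" for i j k
    using that by (simp add: structure_vector_def indices_def)
  have zero: "?l (i, j, k) = 0" if ijk: "i < n" "j < n" "k < n" "k \<noteq> i" "k \<noteq> j" for i j k
  proof -
    obtain \<alpha> \<beta> where "br (b i) (b j) = scale \<alpha> (b i) + scale \<beta> (b j)"
      using combination by blast
    then show ?thesis
      using ijk by (simp add: l coordinate_add coordinate_scale coordinate_basis)
  qed
  have same: "?l (i, j, i) = ?l (k, j, k)" if ijk: "i < n" "j < n" "k < n" "i \<noteq> j" "k \<noteq> j" for i j k
  proof (cases "i = k")
    case False
    obtain \<alpha> \<beta> where \<alpha>: "br (b i + b k) (b j) = scale \<alpha> (b i + b k) + scale \<beta> (b j)"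
      using combination by blast
    have "br (b i + b k) (b j) = br (b i) (b j) + br (b k) (b j)"
      using alg(1) by (simp add: nonassoc_algebra_def Vector_Spaces.linear_iff)
    then have "?l (i, j, m) + ?l (k, j, m) = coord (scale \<alpha> (b i + b k) + scale \<beta> (b j)) m"
      if "m < n" for m
      using that ijk \<alpha> by (metis l coordinate_add)
    \<comment> \<open>The coordinates at \<open>i\<close> and at \<open>k\<close> of the right-hand
      side are both \<alpha>; on the left the mixed entries vanish by \<open>zero\<close>.\<close>
    from this[of i] this[of k] show ?thesis
      using ijk False zero[of k j i] zero[of i j k]
      by (simp add: coordinate_add coordinate_scale coordinate_basis)
  qed simp
  define s where "s j = (if j = 0 then 1 else 0 :: nat)" for j :: nat
  have s: "s j < n" "s j \<noteq> j" for j
    using n by (auto simp: s_def)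
  define f where "f j = ?l (s j, j, s j)" for j
  have f: "?l (i, j, i) = f j" if "i < n" "j < n" "i \<noteq> j" for i j
    unfolding f_def using same that s by metis
  have neg: "?l (i, j, k) = - ?l (j, i, k)" if "i < n" "j < n" "k < n" for i j k
    using that alternating_antisymmetric[OF alg, of "b i" "b j"]
    by (simp add: l coordinate_minus)
  \<comment> \<open>In characteristic 2 this does not follow from \<open>neg\<close>.\<close>
  have diag: "?l (i, i, k) = 0" if "i < n" "k < n" for i k
    using that by (simp add: l alg(2) coordinate_zero)
  have "?l = r_vector n f"
  proof (rule affine_space_eqI)
    fix i j k assume ijk: "i < n" "j < n" "k < n"
    consider "i = j" | "i \<noteq> j" "k = i" | "i \<noteq> j" "k = j" | "i \<noteq> j" "k \<noteq> i" "k \<noteq> j"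
      by blast
    then show "?l (i, j, k) = r_vector n f (i, j, k)"
    proof cases
      case 3
      then show ?thesis
        using ijk neg[of i j j] f[of j i] by (simp add: r_vector_entry)
    qed (use ijk diag f zero in \<open>auto simp: r_vector_entry\<close>)
  qed simp_all
  then show ?thesis by blast
qed

lemma h_vector_in_closure:
  fixes scale :: "'f::field \<Rightarrow> 'v::ab_group_add \<Rightarrow> 'v"
  assumes n: "n \<ge> 3" and inf: "infinite (UNIV :: 'f set)"
    and alg: "nonassoc_algebra scale n br" "\<And>x. br x x = 0"
    and xy: "br x y \<notin> module.span scale {x, y}"
  shows "h_vector n (unit 0) (unit 1) (unit 2) \<in> zariski_topology n closure_of structure_vectors scale n br"
proof -
  obtain b where "ordered_basis scale n b"
    using alg(1) by (auto simp: nonassoc_algebra_def)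
  then interpret B: based_space scale n b by (simp add: based_space_iff)
  have lin: "br (scale a u) w = scale a (br u w)" "br u (scale a w) = scale a (br u w)" for a u w
    using alg(1) by (simp_all add: nonassoc_algebra_def Vector_Spaces.linear_iff)
  have "br x y \<noteq> 0"
    using xy B.span_zero by metis
  have "y \<noteq> 0"
    using \<open>br x y \<noteq> 0\<close> lin(2)[of x 0 y] by auto
  \<comment> \<open>If \<open>x\<close> were a multiple of \<open>y\<close>, then [x, y] would be a
    multiple of [y, y] = 0.\<close>
  moreover have "x \<notin> B.span {y}"
    using \<open>br x y \<noteq> 0\<close> alg(2) by (auto simp: B.span_singleton lin)
  ultimately have "B.independent {br x y, x, y}"
    using xy by (intro B.independent_insertI) (simp_all add: insert_commute B.independent_empty)
  then obtain S where S: "{br x y, x, y} \<subseteq> S" "B.independent S" "UNIV \<subseteq> B.span S"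
    by (rule B.maximal_independent_subset_extend[OF subset_UNIV])
  have span: "B.span S = UNIV" and mem: "x \<in> S" "y \<in> S" "br x y \<in> S"
    using S(1,3) by auto
  have "x \<noteq> br x y" "y \<noteq> br x y"
    using xy B.span_base[of _ "{x, y}"] by auto
  moreover have "x \<noteq> y"
    using \<open>br x y \<noteq> 0\<close> alg(2) by auto
  ultimately obtain c where c: "ordered_basis scale n c" "c 0 = x" "c 1 = y" "c 2 = br x y"
    using B.ordered_basis_of_set3[OF S(2) span n mem] by blast
  interpret C: based_space scale n c using c by (simp add: based_space_iff)
  let ?l = "structure_vector scale n c br"
  \<comment> \<open>Since w i + w j is at least 2 and w k at most 2, equality holds only for
    \<open>i\<close>, \<open>j\<close> below 2 and \<open>k\<close> at least 2. What survives is the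
    part of [c_0, c_1] and [c_1, c_0] outside the plane of \<open>x\<close> and \<open>y\<close>,
    and this is the whole product because \<open>c 2\<close> was chosen as [x, y].\<close>
  define w where "w i = (if i < 2 then 1 else 2 :: nat)" for i :: nat
  have l: "?l (i, j, k) = C.coord (br (c i) (c j)) k" if "i < n" "j < n" "k < n" for i j k
    using that by (simp add: structure_vector_def indices_def)
  have l_antisym: "?l (1, 0, k) = - unit 2 k" "?l (0, 1, k) = unit 2 k" if "k < n" for k
  proof -
    have "br (c 1) (c 0) = - c 2" "br (c 0) (c 1) = c 2"
      using alternating_antisymmetric[OF alg, of x y] c by simp_all
    then show "?l (1, 0, k) = - unit 2 k" "?l (0, 1, k) = unit 2 k"
      using that n by (simp_all add: l C.coordinate_minus C.coordinate_basis)
  qed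
  have "(\<lambda>(i, j, k)\<in>indices n. if w i + w j = w k then ?l (i, j, k) else 0)
      \<in> zariski_topology n closure_of structure_vectors scale n br"
    by (rule weighted_degeneration[OF inf c(1) alg(1)]) (auto simp: w_def)
  also have "(\<lambda>(i, j, k)\<in>indices n. if w i + w j = w k then ?l (i, j, k) else 0)
      = h_vector n (unit 0) (unit 1) (unit 2)"
  proof (rule affine_space_eqI)
    fix i j k assume ijk: "i < n" "j < n" "k < n"
    have "(if w i + w j = w k then ?l (i, j, k) else 0)
        = (unit 0 i * unit 1 j - unit 0 j * unit 1 i) * unit 2 k"
    proof (cases "w i + w j = w k")
      case True
      then have "i < 2" "j < 2"
        by (auto simp: w_def split: if_splits)
      then consider "i = j" | "i = 0" "j = 1" | "i = 1" "j = 0"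
        by linarith
      then show ?thesis
      proof cases
        case 1
        then show ?thesis
          using ijk by (simp add: l alg(2) C.coordinate_zero)
      qed (use True ijk l_antisym[of k] in simp_all)
    next
      case False
      then have "\<not> (i < 2 \<and> j < 2 \<and> k = 2)"
        by (auto simp: w_def)
      then show ?thesis
        using False by auto
    qed
    then show "(\<lambda>(i, j, k)\<in>indices n. if w i + w j = w k then ?l (i, j, k) else 0) (i, j, k)
        = h_vector n (unit 0) (unit 1) (unit 2) (i, j, k)"
      using ijk by (simp only: h_vector_entry) (simp add: indices_def)
  qed (simp_all add: affine_space_def h_vector_def)
  finally show ?thesis .
qed

theorem theorem1p1:
  fixes n :: nat
    and scaleV :: "'f::field \<Rightarrow> 'v::ab_group_add \<Rightarrow> 'v"
    and v :: "nat \<Rightarrow> 'v"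
    and scaleW :: "'f \<Rightarrow> 'w::ab_group_add \<Rightarrow> 'w"
    and bracket :: "'w \<Rightarrow> 'w \<Rightarrow> 'w"
  assumes "n \<ge> 3"
    and "infinite (UNIV :: 'f set)"
    and "ordered_basis scaleV n v"
    and "nonassoc_algebra scaleW n bracket"
    and "\<forall>x. bracket x x = 0"
  shows "(\<forall>bracket' :: 'v \<Rightarrow> 'v \<Rightarrow> 'v. nonassoc_algebra scaleV n bracket' \<longrightarrow>
            (properly_degenerates scaleV n v scaleW bracket scaleV bracket' \<longleftrightarrow>
             algebra_isomorphic scaleV bracket' scaleV a_algebra))
      \<longleftrightarrow> (algebra_isomorphic scaleW bracket scaleV (r_algebra scaleV n v) \<or>
           algebra_isomorphic scaleW bracket scaleV (h_algebra scaleV n v))"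
    (is "?only_abelian \<longleftrightarrow> ?r \<or> ?h")
proof
  interpret V: based_space scaleV n v using assms(3) by (simp add: based_space_iff)
  let ?SW = "structure_vectors scaleW n bracket"
  let ?rvec = "r_vector n (unit (n - 1)) :: index \<Rightarrow> 'f"
  let ?hvec = "h_vector n (unit 0) (unit 1) (unit 2) :: index \<Rightarrow> 'f"
  note inf = assms(2) and v = assms(3) and W = assms(4)
  have n2: "n \<ge> 2" using assms(1) by simp
  have alt: "bracket x x = 0" for x using assms(5) by simp
  have r_alg: "nonassoc_algebra scaleV n (r_algebra scaleV n v)"
    unfolding r_algebra_def by (rule V.nonassoc_algebra_bilinear_extension)
  have h_alg: "nonassoc_algebra scaleV n (h_algebra scaleV n v)"
    unfolding h_algebra_def by (rule V.nonassoc_algebra_bilinear_extension)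
  have r0: "?rvec \<in> structure_vectors scaleV n (r_algebra scaleV n v)"
    using V.structure_vector_in_structure_vectors V.structure_vector_r_algebra by metis
  have h0: "?hvec \<in> structure_vectors scaleV n (h_algebra scaleV n v)"
    using V.structure_vector_in_structure_vectors V.structure_vector_h_algebra[OF assms(1)] by metis
  have zero: "zero_vector n \<notin> ?SW" if "l \<in> ?SW" "l \<noteq> zero_vector n" for l
    using structure_vectors_abelian[OF W] that by blast
  {
    assume "?r \<or> ?h"
    then consider ?r | ?h by blast
    then show ?only_abelian
    proof cases
      case 1
      from structure_vectors_isomorphic[OF this, of n] have r0W: "?rvec \<in> ?SW"
        using r0 by simp
      show ?thesis
      proof (intro allI impI)
        fix bracket' assume V': "nonassoc_algebra scaleV n bracket'"
        show "properly_degenerates scaleV n v scaleW bracket scaleV bracket'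
          \<longleftrightarrow> algebra_isomorphic scaleV bracket' scaleV a_algebra"
        proof (rule properly_degenerates_iff_abelian[OF inf v W V' closedin_r_vectors[OF n2] _ _ r0W])
          show "?SW \<subseteq> range (r_vector n)"
            by (rule structure_vectors_subset_r_vectors[OF W r0W])
          show "zero_vector n \<notin> ?SW"
            by (rule zero[OF r0W r_vector_unit_nonzero[OF n2]])
        qed (use standard_r_vector_in_structure_vectors[OF V'] in blast)
      qed
    next
      case 2
      from structure_vectors_isomorphic[OF this, of n] have h0W: "?hvec \<in> ?SW"
        using h0 by simp
      show ?thesis
      proof (intro allI impI)
        fix bracket' assume V': "nonassoc_algebra scaleV n bracket'"
        show "properly_degenerates scaleV n v scaleW bracket scaleV bracket'
          \<longleftrightarrow> algebra_isomorphic scaleV bracket' scaleV a_algebra"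
        proof (rule properly_degenerates_iff_abelian[OF inf v W V' closedin_h_vectors _ _ h0W])
          show "?SW \<subseteq> h_vectors n"
            by (rule structure_vectors_subset_h_vectors[OF W h_vector_unit_in_h_vectors h0W])
          show "zero_vector n \<notin> ?SW"
            by (rule zero[OF h0W h_vector_unit_nonzero[OF assms(1)]])
        qed (rule standard_h_vector_in_structure_vectors[OF assms(1) V'])
      qed
    qed
  }
  assume only_abelian: ?only_abelian
  \<comment> \<open>An abelian algebra has the zero vector as its only structure vector and so does
    not properly degenerate to a_n, whereas the assumed equivalence requires a_n to be
    reached.\<close>
  have nonabelian: "zero_vector n \<notin> ?SW"
  proof
    assume "zero_vector n \<in> ?SW"
    then have "\<not> properly_degenerates scaleV n v scaleW bracket scaleV a_algebra"
      unfolding properly_degenerates_iff[OF v W] structure_vectors_a_algebra[OF v] by simp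
    moreover have "algebra_isomorphic scaleV a_algebra scaleV a_algebra"
      unfolding isomorphic_a_algebra_iff[OF v nonassoc_algebra_a_algebra[OF v]]
        structure_vectors_a_algebra[OF v] by simp
    ultimately show False
      using only_abelian nonassoc_algebra_a_algebra[OF v] by blast
  qed
  show "?r \<or> ?h"
  proof (cases "\<forall>x y. bracket x y \<in> module.span scaleW {x, y}")
    case True
    obtain b where b: "ordered_basis scaleW n b"
      using W by (auto simp: nonassoc_algebra_def)
    let ?l = "structure_vector scaleW n b bracket"
    have l: "?l \<in> ?SW"
      using b unfolding structure_vectors_def by blast
    obtain f where f: "?l = r_vector n f"
      using structure_vector_of_planar_bracket[OF b n2 W alt] True by blast
    have "r_vector n f \<in> ?SW" "r_vector n f \<noteq> zero_vector n"
      using l nonabelian unfolding f by auto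
    then have "?rvec \<in> ?SW"
      by (rule standard_r_vector_in_structure_vectors[OF W])
    then have ?r
      by (rule algebra_isomorphic_if_common_structure_vector[OF W r_alg _ r0])
    then show ?thesis ..
  next
    case False
    then obtain x y where "bracket x y \<notin> module.span scaleW {x, y}"
      by blast
    from h_vector_in_closure[OF assms(1) inf W alt this]
    have closure: "?hvec \<in> zariski_topology n closure_of ?SW" .
    \<comment> \<open>Otherwise h_n would be a proper degeneration, hence abelian by assumption,
      which its nonzero structure vector forbids.\<close>
    have "?hvec \<in> ?SW"
    proof (rule ccontr)
      assume "?hvec \<notin> ?SW"
      then have "properly_degenerates scaleV n v scaleW bracket scaleV (h_algebra scaleV n v)"
        unfolding properly_degenerates_iff[OF v W] using closure h0 by blast
      then have "algebra_isomorphic scaleV (h_algebra scaleV n v) scaleV a_algebra"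
        using only_abelian h_alg by blast
      from structure_vectors_isomorphic[OF this, of n] show False
        using h0 structure_vectors_a_algebra[OF v] h_vector_unit_nonzero[OF assms(1)] by auto
    qed
    then have ?h
      by (rule algebra_isomorphic_if_common_structure_vector[OF W h_alg _ h0])
    then show ?thesis ..
  qed
qed

end
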